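(* Let $s\ge1$ be arbitrary. Then for $R$ sufficiently small and $M$ sufficiently large (i.e. there exist $R_0\in(0,1/2)$ and $M_0>0$ such that for all $0<R\le R_0$ and $M\ge M_0$), there exists $c>0$ such that the Kolmogorov $n$-widths of the class $\mathcal{F}_{s,R,M}$ satisfy $$d_n(\mathcal{F}_{s,R,M})_{L^2(D)}\ge c\,n^{-\frac14},\qquad n\ge1.$$
   Context: $D=[0,1]^2$. For a subset $K$ of a Banach space $V$, the Kolmogorov $n$-width is $d_n(K)_V:=\inf_{\dim(E)\le n}\operatorname{dist}(K,E)_V$, where $\operatorname{dist}(K,E)_V:=\sup_{u\in K}\min_{v\in E}\|u-v\|_V$ and the infimum is over all linear subspaces $E\subset V$ of dimension at most $n$. Class $\mathcal{F}_{s,R,M}$ ($s\ge1$, $0<R<1/2$, $M>0$): it consists of all characteristic functions $\chi_\Omega$ of domains $\Omega\subset[R,1-R]^2\subset D$ with the following property: for all $x\in D$ there exist an orthonormal system $(e_1,e_2)$ of $\mathbb{R}^2$ and a function $\psi\in\mathcal{C}^s([-R,R])$ with $\|\psi\|_{\mathcal{C}^s}\le M$ such that, for any $y=x+z_1e_1+z_2e_2$ with $|z_1|,|z_2|\le R$, one has $y\in\Omega\iff z_2\le\psi(z_1)$. Hölder norm: with $k_s:=\lceil s\rceil-1$ (equal to $\lfloor s\rfloor$ for non-integer $s$ and to $s-1$ for integer $s$), $$\|\psi\|_{\mathcal{C}^s}=\sup_{0\le k\le k_s}\|\psi^{(k)}\|_{L^\infty([-R,R])}+\sup_{a\ne b\in[-R,R]}\frac{|\psi^{(k_s)}(a)-\psi^{(k_s)}(b)|}{|a-b|^{s-k_s}}.$$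 So for integer $s$, $\mathcal{C}^s$ denotes functions with Lipschitz derivatives up to order $s-1$. *)

theory Defs
  imports "HOL-Analysis.Analysis"
begin

section \<open>The Hilbert space of square-integrable functions on the unit square\<close>

definition unit_square :: "(real \<times> real) set"
  where "unit_square = {0..1} \<times> {0..1}"

definition square_integrable_on_square :: "(real \<times> real \<Rightarrow> real) \<Rightarrow> bool"
  where "square_integrable_on_square f \<longleftrightarrow>
    f \<in> borel_measurable (lebesgue_on unit_square) \<and>
    integrable (lebesgue_on unit_square) (\<lambda>x. (f x)\<^sup>2)"

definition ae_equal_on_square :: "(real \<times> real \<Rightarrow> real) \<Rightarrow> (real \<times> real \<Rightarrow> real) \<Rightarrow> bool"
  where "ae_equal_on_square f g \<longleftrightarrow>
    square_integrable_on_square f \<and> square_integrable_on_square g \<and>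
    (AE x in lebesgue_on unit_square. f x = g x)"

lemma square_integrable_on_square_prod:
  assumes "square_integrable_on_square f" "square_integrable_on_square g"
  shows "integrable (lebesgue_on unit_square) (\<lambda>x. f x * g x)"
proof (rule Bochner_Integration.integrable_bound)
  show "integrable (lebesgue_on unit_square) (\<lambda>x. (f x)\<^sup>2 + (g x)\<^sup>2)"
    using assms by (auto simp: square_integrable_on_square_def)
  show "(\<lambda>x. f x * g x) \<in> borel_measurable (lebesgue_on unit_square)"
    using assms by (auto simp: square_integrable_on_square_def)
  have "\<bar>a * b\<bar> \<le> a\<^sup>2 + b\<^sup>2" for a b :: real
  proof -
    have "2 * (\<bar>a\<bar> * \<bar>b\<bar>) \<le> \<bar>a\<bar>\<^sup>2 + \<bar>b\<bar>\<^sup>2"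
      using sum_squares_bound[of "\<bar>a\<bar>" "\<bar>b\<bar>"] by (simp add: mult.assoc)
    moreover have "0 \<le> \<bar>a\<bar> * \<bar>b\<bar>" by simp
    ultimately show ?thesis by (simp add: abs_mult del: mult_nonneg_nonneg)
  qed
  then show "AE x in lebesgue_on unit_square. norm (f x * g x) \<le> norm ((f x)\<^sup>2 + (g x)\<^sup>2)"
    by (auto intro!: AE_I2)
qed

lemma square_integrable_on_square_add:
  assumes "square_integrable_on_square f" "square_integrable_on_square g"
  shows "square_integrable_on_square (\<lambda>x. f x + g x)"
  using assms square_integrable_on_square_prod[OF assms]
  by (auto simp: square_integrable_on_square_def power2_sum mult.assoc)

lemma square_integrable_on_square_scale:
  assumes "square_integrable_on_square f"
  shows "square_integrable_on_square (\<lambda>x. c * f x)"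
  using assms by (auto simp: square_integrable_on_square_def power_mult_distrib)

lemma square_integrable_on_square_diff:
  assumes "square_integrable_on_square f" "square_integrable_on_square g"
  shows "square_integrable_on_square (\<lambda>x. f x - g x)"
  using square_integrable_on_square_add[OF assms(1) square_integrable_on_square_scale[OF assms(2), of "-1"]]
  by simp

lemma square_integrable_on_square_zero: "square_integrable_on_square (\<lambda>_. 0)"
  by (simp add: square_integrable_on_square_def)

lemma part_equivp_ae_equal_on_square: "part_equivp ae_equal_on_square"
proof (rule part_equivpI)
  show "\<exists>f. ae_equal_on_square f f"
    using square_integrable_on_square_zero by (auto simp: ae_equal_on_square_def)
  show "symp ae_equal_on_square"
    by (rule sympI) (auto simp: ae_equal_on_square_def)
  show "transp ae_equal_on_square"
    by (rule transpI) (auto simp: ae_equal_on_square_def)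
qed

quotient_type L2_square = "real \<times> real \<Rightarrow> real" / partial: ae_equal_on_square
  by (rule part_equivp_ae_equal_on_square)

instantiation L2_square :: real_inner
begin

lift_definition zero_L2_square :: L2_square is "\<lambda>_. 0"
  using square_integrable_on_square_zero by (simp add: ae_equal_on_square_def)

lift_definition plus_L2_square :: "L2_square \<Rightarrow> L2_square \<Rightarrow> L2_square"
  is "\<lambda>f g x. f x + g x"
  by (auto simp: ae_equal_on_square_def intro: square_integrable_on_square_add)

lift_definition minus_L2_square :: "L2_square \<Rightarrow> L2_square \<Rightarrow> L2_square"
  is "\<lambda>f g x. f x - g x"
  by (auto simp: ae_equal_on_square_def intro: square_integrable_on_square_diff)

lift_definition uminus_L2_square :: "L2_square \<Rightarrow> L2_square"
  is "\<lambda>f x. - f x"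
  using square_integrable_on_square_scale[of _ "-1"] by (auto simp: ae_equal_on_square_def)

lift_definition scaleR_L2_square :: "real \<Rightarrow> L2_square \<Rightarrow> L2_square"
  is "\<lambda>c f x. c * f x"
  by (auto simp: ae_equal_on_square_def intro: square_integrable_on_square_scale)

lift_definition inner_L2_square :: "L2_square \<Rightarrow> L2_square \<Rightarrow> real"
  is "\<lambda>f g. integral\<^sup>L (lebesgue_on unit_square) (\<lambda>x. f x * g x)"
proof -
  fix f f' g g' :: "real \<times> real \<Rightarrow> real"
  assume "ae_equal_on_square f f'" "ae_equal_on_square g g'"
  then show "integral\<^sup>L (lebesgue_on unit_square) (\<lambda>x. f x * g x)
    = integral\<^sup>L (lebesgue_on unit_square) (\<lambda>x. f' x * g' x)"
    by (intro integral_cong_AE)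
       (auto simp: ae_equal_on_square_def square_integrable_on_square_def)
qed

definition norm_L2_square :: "L2_square \<Rightarrow> real"
  where "norm_L2_square u = sqrt (inner u u)"

definition sgn_L2_square :: "L2_square \<Rightarrow> L2_square"
  where "sgn_L2_square u = scaleR (inverse (norm u)) u"

definition dist_L2_square :: "L2_square \<Rightarrow> L2_square \<Rightarrow> real"
  where "dist_L2_square u v = norm (u - v)"

definition uniformity_L2_square :: "(L2_square \<times> L2_square) filter"
  where "uniformity_L2_square = (INF e\<in>{0<..}. principal {(u, v). dist u v < e})"

definition open_L2_square :: "L2_square set \<Rightarrow> bool"
  where "open_L2_square U \<longleftrightarrow> (\<forall>u\<in>U. eventually (\<lambda>(u', v). u' = u \<longrightarrow> v \<in> U) uniformity)"

instance
proof
  fix u v w :: L2_square and a b :: real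
  show "u + v + w = u + (v + w)"
    by transfer
       (simp add: ae_equal_on_square_def add.assoc square_integrable_on_square_add)
  show "u + v = v + u"
    by transfer
       (simp add: ae_equal_on_square_def add.commute square_integrable_on_square_add)
  show "0 + u = u"
    by transfer (simp add: ae_equal_on_square_def)
  show "- u + u = 0"
    by transfer (simp add: ae_equal_on_square_def square_integrable_on_square_zero)
  show "u - v = u + - v"
    by transfer (simp add: ae_equal_on_square_def square_integrable_on_square_diff)
  show "a *\<^sub>R (u + v) = a *\<^sub>R u + a *\<^sub>R v"
    by transfer
       (simp add: ae_equal_on_square_def distrib_left
        square_integrable_on_square_add square_integrable_on_square_scale)
  show "(a + b) *\<^sub>R u = a *\<^sub>R u + b *\<^sub>R u"
    by transfer
       (simp add: ae_equal_on_square_def distrib_right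
        square_integrable_on_square_add square_integrable_on_square_scale)
  show "a *\<^sub>R b *\<^sub>R u = (a * b) *\<^sub>R u"
    by transfer
       (simp add: ae_equal_on_square_def mult.assoc square_integrable_on_square_scale)
  show "1 *\<^sub>R u = u"
    by transfer (simp add: ae_equal_on_square_def)
  show "dist u v = norm (u - v)" by (rule dist_L2_square_def)
  show "sgn u = scaleR (inverse (norm u)) u" by (rule sgn_L2_square_def)
  show "(uniformity :: (L2_square \<times> L2_square) filter)
      = (INF e\<in>{0<..}. principal {(u, v). dist u v < e})"
    by (rule uniformity_L2_square_def)
  show "open U \<longleftrightarrow> (\<forall>u\<in>U. eventually (\<lambda>(u', v). u' = u \<longrightarrow> v \<in> U) uniformity)"
    for U :: "L2_square set"
    by (rule open_L2_square_def)
  show "norm u = sqrt (inner u u)" by (rule norm_L2_square_def)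
  show "inner u v = inner v u"
    by transfer (simp add: mult.commute)
  show "inner (u + v) w = inner u w + inner v w"
    by transfer
       (simp add: ae_equal_on_square_def distrib_right square_integrable_on_square_prod)
  show "inner (a *\<^sub>R u) v = a * inner u v"
    by transfer (simp add: mult.assoc)
  show "0 \<le> inner u u"
    by transfer simp
  show "inner u u = 0 \<longleftrightarrow> u = 0"
  proof (transfer, goal_cases)
    case (1 f)
    then have f: "square_integrable_on_square f" by (simp add: ae_equal_on_square_def)
    then show ?case
      using integral_nonneg_eq_0_iff_AE[OF square_integrable_on_square_prod[OF f f]]
      by (simp add: ae_equal_on_square_def square_integrable_on_square_zero)
  qed
qed

end

section \<open>Kolmogorov widths\<close>

text \<open>
  The constant \<^term>\<open>dim\<close> is \<^term>\<open>0::nat\<close> on spaces without finite basis, so finite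
  dimensionality is a separate requirement. Values are extended reals because the
  supremum over \<^term>\<open>K\<close> may be infinite.
\<close>

definition subspace_dist :: "'a::real_normed_vector set \<Rightarrow> 'a set \<Rightarrow> ereal"
  where "subspace_dist K E = (SUP u\<in>K. INF v\<in>E. ereal (norm (u - v)))"

definition kolmogorov_width :: "nat \<Rightarrow> 'a::real_normed_vector set \<Rightarrow> ereal"
  where "kolmogorov_width n K =
    (INF E\<in>{E. subspace E \<and> (\<exists>B. finite B \<and> span B = E) \<and> dim E \<le> n}. subspace_dist K E)"

section \<open>Hoelder functions on a symmetric interval\<close>

definition holder_order :: "real \<Rightarrow> nat"
  where "holder_order s = nat (\<lceil>s\<rceil> - 1)"

text \<open>Derivatives at the endpoints of the interval are one-sided.\<close>

primrec interval_deriv :: "real \<Rightarrow> (real \<Rightarrow> real) \<Rightarrow> nat \<Rightarrow> real \<Rightarrow> real"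
  where
    "interval_deriv R \<psi> 0 = \<psi>"
  | "interval_deriv R \<psi> (Suc k) =
      (\<lambda>t. vector_derivative (interval_deriv R \<psi> k) (at t within {-R..R}))"

text \<open>
  The sup norm stands for the essential supremum; the two agree for continuous functions,
  and all derivatives of a Hoelder function that occur here are continuous.
\<close>

definition holder_norm :: "real \<Rightarrow> real \<Rightarrow> (real \<Rightarrow> real) \<Rightarrow> ereal"
  where "holder_norm s R \<psi> =
    (SUP k\<in>{0..holder_order s}. SUP t\<in>{-R..R}. ereal \<bar>interval_deriv R \<psi> k t\<bar>) +
    (SUP (a, b)\<in>{(a, b). a \<in> {-R..R} \<and> b \<in> {-R..R} \<and> a \<noteq> b}.
      ereal (\<bar>interval_deriv R \<psi> (holder_order s) a - interval_deriv R \<psi> (holder_order s) b\<bar>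
        / \<bar>a - b\<bar> powr (s - real (holder_order s))))"

definition holder_space :: "real \<Rightarrow> real \<Rightarrow> (real \<Rightarrow> real) set"
  where "holder_space s R =
    {\<psi>. (\<forall>k<holder_order s. interval_deriv R \<psi> k differentiable_on {-R..R}) \<and>
         holder_norm s R \<psi> < \<infinity>}"

section \<open>Characteristic functions of domains with Hoelder boundary\<close>

text \<open>
  The local condition forces such a set to be closed (see below), so a ``domain'' here is
  not an open set, and it need not be connected.
\<close>

definition holder_domain :: "real \<Rightarrow> real \<Rightarrow> real \<Rightarrow> (real \<times> real) set \<Rightarrow> bool"
  where "holder_domain s R M \<Omega> \<longleftrightarrow>
    \<Omega> \<subseteq> {R..1 - R} \<times> {R..1 - R} \<and>
    (\<forall>x\<in>unit_square. \<exists>e1 e2 \<psi>.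
      norm e1 = 1 \<and> norm e2 = 1 \<and> inner e1 e2 = 0 \<and>
      \<psi> \<in> holder_space s R \<and> holder_norm s R \<psi> \<le> ereal M \<and>
      (\<forall>z1 z2. \<bar>z1\<bar> \<le> R \<and> \<bar>z2\<bar> \<le> R \<longrightarrow>
        (x + z1 *\<^sub>R e1 + z2 *\<^sub>R e2 \<in> \<Omega> \<longleftrightarrow> z2 \<le> \<psi> z1)))"

text \<open>
  \<^term>\<open>abs_L2_square f\<close> is the class of \<^term>\<open>f\<close> only for square-integrable \<^term>\<open>f\<close>;
  this holds for the indicators used here, as shown below.
\<close>

definition holder_domain_class :: "real \<Rightarrow> real \<Rightarrow> real \<Rightarrow> L2_square set"
  where "holder_domain_class s R M = {abs_L2_square (indicat_real \<Omega>) | \<Omega>. holder_domain s R M \<Omega>}"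

lemma holder_space_continuous_on:
  assumes "1 \<le> s" "\<psi> \<in> holder_space s R"
  shows "continuous_on {-R..R} \<psi>"
proof (cases "holder_order s")
  case (Suc k)
  then have "interval_deriv R \<psi> 0 differentiable_on {-R..R}"
    using assms by (auto simp: holder_space_def simp del: interval_deriv.simps)
  then show ?thesis by (simp add: differentiable_imp_continuous_on)
next
  case 0
  let ?P = "{(a, b). a \<in> {-R..R} \<and> b \<in> {-R..R} \<and> a \<noteq> b}"
  let ?h = "SUP (a, b)\<in>?P. ereal (\<bar>\<psi> a - \<psi> b\<bar> / \<bar>a - b\<bar> powr s)"
  show ?thesis
  proof (cases "R \<le> 0")
    case True
    then have "{-R..R} \<subseteq> {R}" by auto
    then show ?thesis by (meson continuous_on_sing continuous_on_subset)
  next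
    case False
    have sup: "0 \<le> (SUP t\<in>{-R..R}. ereal \<bar>\<psi> t\<bar>)"
      using False by (intro SUP_upper2[of 0]) auto
    have "(SUP t\<in>{-R..R}. ereal \<bar>\<psi> t\<bar>) + ?h < \<infinity>"
      using assms 0 by (simp add: holder_space_def holder_norm_def)
    then have "?h < \<infinity>" using sup by (cases ?h) auto
    moreover have "\<exists>C. h \<le> ereal C \<and> 0 \<le> C" if "h < \<infinity>" for h :: ereal
    proof (cases h)
      case (real r)
      then show ?thesis by (intro exI[of _ "max r 0"]) simp
    next
      case MInf
      then show ?thesis by (intro exI[of _ 0]) simp
    next
      case PInf
      with that show ?thesis by simp
    qed
    ultimately have "\<exists>C. ?h \<le> ereal C \<and> 0 \<le> C"
      by iprover
    then obtain C where C: "?h \<le> ereal C" "0 \<le> C"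
      by iprover
    have bound: "\<bar>\<psi> a - \<psi> b\<bar> \<le> C * \<bar>a - b\<bar> powr s" if "a \<in> {-R..R}" "b \<in> {-R..R}" for a b
    proof (cases "a = b")
      case False
      have "ereal (\<bar>\<psi> a - \<psi> b\<bar> / \<bar>a - b\<bar> powr s) \<le> ?h"
        using that False by (intro SUP_upper2[of "(a, b)"]) auto
      from order_trans[OF this C(1)] have "\<bar>\<psi> a - \<psi> b\<bar> / \<bar>a - b\<bar> powr s \<le> C"
        by (simp only: ereal_less_eq)
      then show ?thesis using False by (simp add: divide_le_eq)
    qed (use C in simp)
    show ?thesis
      unfolding continuous_on_def
    proof
      fix a assume a: "a \<in> {-R..R}"
      have "((\<lambda>b. C * \<bar>b - a\<bar> powr s) \<longlongrightarrow> C * 0 powr s) (at a within {-R..R})"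
        using assms(1) by (auto intro!: tendsto_eq_intros)
      then have lim: "((\<lambda>b. C * \<bar>b - a\<bar> powr s) \<longlongrightarrow> 0) (at a within {-R..R})" by simp
      have "\<forall>\<^sub>F b in at a within {-R..R}. norm (\<psi> b - \<psi> a) \<le> C * \<bar>b - a\<bar> powr s"
        unfolding eventually_at_filter
        by (intro always_eventually allI impI) (simp only: real_norm_def bound[OF _ a])
      then show "(\<psi> \<longlongrightarrow> \<psi> a) (at a within {-R..R})"
        by (rule LIM_zero_cancel[OF Lim_null_comparison[OF _ lim]])
    qed
  qed
qed

lemma holder_domain_closed:
  assumes "1 \<le> s" "0 < R" "holder_domain s R M \<Omega>"
  shows "closed \<Omega>"
  unfolding closed_sequential_limits
proof (intro allI impI, elim conjE)
  fix y l assume y: "\<forall>n. y n \<in> \<Omega>" and lim: "y \<longlonglongrightarrow> l"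
  have sub: "\<Omega> \<subseteq> unit_square"
    using assms unfolding holder_domain_def unit_square_def by fastforce
  have "closed unit_square"
    by (simp add: unit_square_def closed_Times)
  then have "l \<in> unit_square"
    using y lim sub by (metis closed_sequentially subsetD)
  then obtain e1 e2 \<psi> where e: "norm e1 = 1" "norm e2 = 1" "inner e1 e2 = 0"
    and \<psi>: "\<psi> \<in> holder_space s R"
    and loc: "\<And>z1 z2. \<bar>z1\<bar> \<le> R \<Longrightarrow> \<bar>z2\<bar> \<le> R \<Longrightarrow>
      l + z1 *\<^sub>R e1 + z2 *\<^sub>R e2 \<in> \<Omega> \<longleftrightarrow> z2 \<le> \<psi> z1"
    using assms(3) unfolding holder_domain_def by metis
  have expand: "w = inner w e1 *\<^sub>R e1 + inner w e2 *\<^sub>R e2" for w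
  proof -
    have n: "fst e1 * fst e1 + snd e1 * snd e1 = 1" "fst e2 * fst e2 + snd e2 * snd e2 = 1"
      "fst e1 * fst e2 + snd e1 * snd e2 = 0"
      using e by (simp_all add: norm_eq_1 inner_prod_def)
    have m: "fst e1 * fst e1 + fst e2 * fst e2 = 1" "snd e1 * snd e1 + snd e2 * snd e2 = 1"
      "fst e1 * snd e1 + fst e2 * snd e2 = 0"
      using n by algebra+
    show ?thesis
    proof (rule prod_eqI)
      have "fst w = fst w * (fst e1 * fst e1 + fst e2 * fst e2) + snd w * (fst e1 * snd e1 + fst e2 * snd e2)"
        using m by simp
      then show "fst w = fst (inner w e1 *\<^sub>R e1 + inner w e2 *\<^sub>R e2)"
        by (simp add: inner_prod_def algebra_simps)
      have "snd w = snd w * (snd e1 * snd e1 + snd e2 * snd e2) + fst w * (fst e1 * snd e1 + fst e2 * snd e2)"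
        using m by simp
      then show "snd w = snd (inner w e1 *\<^sub>R e1 + inner w e2 *\<^sub>R e2)"
        by (simp add: inner_prod_def algebra_simps)
    qed
  qed
  define p q where "p n = inner (y n - l) e1" and "q n = inner (y n - l) e2" for n
  have "(\<lambda>n. y n - l) \<longlonglongrightarrow> 0" using lim by (simp add: LIM_zero)
  then have p: "p \<longlonglongrightarrow> 0" and q: "q \<longlonglongrightarrow> 0"
    unfolding p_def q_def
    using tendsto_inner[OF _ tendsto_const, of _ 0 sequentially] by fastforce+
  have ev: "\<forall>\<^sub>F n in sequentially. \<bar>p n\<bar> \<le> R \<and> \<bar>q n\<bar> \<le> R"
    using tendstoD[OF p assms(2)] tendstoD[OF q assms(2)] by eventually_elim auto
  have "continuous (at 0 within {-R..R}) \<psi>"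
    using holder_space_continuous_on[OF assms(1) \<psi>] assms(2)
    by (simp add: continuous_on_eq_continuous_within)
  then have "(\<lambda>n. \<psi> (p n)) \<longlonglongrightarrow> \<psi> 0"
  proof (rule continuous_within_tendsto_compose[where x = p and F = sequentially])
    show "\<forall>\<^sub>F n in sequentially. p n \<in> {-R..R}"
      using ev by eventually_elim auto
  qed (rule p)
  moreover have "\<forall>\<^sub>F n in sequentially. q n \<le> \<psi> (p n)"
    using ev
  proof eventually_elim
    case (elim n)
    have "y n = l + p n *\<^sub>R e1 + q n *\<^sub>R e2"
      using expand[of "y n - l"] by (simp add: p_def q_def algebra_simps)
    then show ?case using loc[of "p n" "q n"] elim y by metis
  qed
  ultimately have "0 \<le> \<psi> 0" using tendsto_le[OF sequentially_bot _ q] by blast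
  then show "l \<in> \<Omega>" using loc[of 0 0] assms(2) by simp
qed

lemma square_integrable_holder_domain:
  assumes "1 \<le> s" "0 < R" "holder_domain s R M \<Omega>"
  shows "square_integrable_on_square (indicat_real \<Omega>)"
proof -
  have "\<Omega> \<in> sets lebesgue"
    using holder_domain_closed[OF assms] by (simp add: borel_closed)
  then have meas: "indicat_real \<Omega> \<in> borel_measurable (lebesgue_on unit_square)"
    by (intro measurable_restrict_space1 borel_measurable_indicator)
  have "unit_square \<in> lmeasurable"
    by (simp add: unit_square_def lmeasurable_compact compact_Times)
  then have fin: "finite_measure (lebesgue_on unit_square)"
    by (rule finite_measure_lebesgue_on)
  have "integrable (lebesgue_on unit_square) (\<lambda>x. (indicat_real \<Omega> x)\<^sup>2)"
  proof (rule finite_measure.integrable_const_bound[OF fin, where B = 1])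
    show "AE x in lebesgue_on unit_square. norm ((indicat_real \<Omega> x)\<^sup>2) \<le> 1"
      by (intro AE_I2) (simp add: indicator_def)
    show "(\<lambda>x. (indicat_real \<Omega> x)\<^sup>2) \<in> borel_measurable (lebesgue_on unit_square)"
      using meas by (rule borel_measurable_power)
  qed
  with meas show ?thesis by (simp add: square_integrable_on_square_def)
qed

end

theory Submission
  imports Defs
begin

text \<open>
  The class contains all discs with centre and radius in suitable small ranges, and no regularity
  of the boundary helps against the freedom to place a jump along curves of two-parameter
  families. We show that the discs centred on the line \<open>y = 1/2\<close>, with varying centre and
  radius, already have widths at least of order \<open>n\<close> to the power \<open>-1/4\<close>.

  In the coordinates \<open>x\<close> and \<open>Y = (x - 1/2)\<^sup>2 + (y - 1/2)\<^sup>2\<close> these discs are half-planes \<open>Y \<le> a x + b\<close>.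
  Multiplication by a bounded weight (\<open>window_weight\<close>) is a linear contraction that restricts to a
  window and absorbs the Jacobian of the substitution, so inner products of the weighted
  indicators are one-dimensional integrals of \<open>min\<close> of two affine functions
  (\<open>inner_window_mult_indicator\<close>).

  Take an \<open>N\<close> by \<open>N\<close> grid of slopes and heights with spacing \<open>\<delta>\<close> of order \<open>1/N\<close>, and form second differences
  in the height. The resulting \<open>N\<^sup>2\<close> atoms are supported on strips of width \<open>\<delta>\<close> and have squared
  norm of order \<open>\<delta>\<close>. They have mean zero across their strips; hence where two of them with
  slopes \<open>j \<delta>\<close> and \<open>j' \<delta>\<close> cross, the leading contribution to their inner product cancels, and integrating
  by parts twice against the smooth weight leaves at most a constant times \<open>\<delta> / (j - j')\<^sup>2\<close>
  (\<open>ramp_integral_by_parts\<close>). So the row sums of their Gram matrix are of order \<open>\<delta>\<close> as well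
  (\<open>sum_diff4_ramp_le\<close>): up to constants the atoms behave like an orthogonal system. By a Bessel
  inequality (\<open>sum_norm_squares_le_of_approx\<close>) a space of dimension \<open>n\<close> captures at most a constant
  times \<open>n \<delta>\<close> of their total energy, which is of order \<open>N\<^sup>2 \<delta>\<close>. If \<open>N\<close> is a large multiple
  of \<open>sqrt n\<close>, some atom is missed by an error of order \<open>sqrt \<delta>\<close>, and so is one of the three discs that
  compose it. Finally \<open>sqrt \<delta>\<close> is of the order of \<open>n\<close> to the power \<open>-1/4\<close>.

  It remains that the discs belong to the class (\<open>holder_domain_disc\<close>): near every point a disc
  is the subgraph of a circular arc shifted by a constant, or everything, and the derivatives of the arcs
  are bounded uniformly in the radius.
\<close>

section \<open>Nearly orthogonal systems and low-dimensional subspaces\<close>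

text \<open>
  Bessel's inequality for a system that is only nearly orthogonal. The row sums of the
  absolute Gram matrix bound its operator norm (Schur test); with
  \<open>y = \<Sum>\<alpha>. \<langle>x \<alpha>, q\<rangle> x \<alpha>\<close> the left-hand side \<open>S\<close> equals \<open>\<langle>y, q\<rangle>\<close>, while
  \<open>\<parallel>y\<parallel>\<^sup>2 \<le> L S\<close>, so that Cauchy-Schwarz gives \<open>S\<^sup>2 \<le> L S \<parallel>q\<parallel>\<^sup>2\<close>.
\<close>

lemma sum_inner_squares_le:
  fixes x :: "'i \<Rightarrow> 'a::real_inner"
  assumes "finite A"
    and row: "\<And>\<alpha>. \<alpha> \<in> A \<Longrightarrow> (\<Sum>\<beta>\<in>A. \<bar>inner (x \<alpha>) (x \<beta>)\<bar>) \<le> L"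
    and "0 \<le> L"
  shows "(\<Sum>\<alpha>\<in>A. (inner (x \<alpha>) q)\<^sup>2) \<le> L * (norm q)\<^sup>2"
proof -
  define s where "s \<alpha> = inner (x \<alpha>) q" for \<alpha>
  define S where "S = (\<Sum>\<alpha>\<in>A. (s \<alpha>)\<^sup>2)"
  define y where "y = (\<Sum>\<alpha>\<in>A. s \<alpha> *\<^sub>R x \<alpha>)"
  have S0: "0 \<le> S" unfolding S_def by (simp add: sum_nonneg)
  have yq: "inner y q = S"
    by (simp add: y_def S_def s_def inner_sum_left power2_eq_square)
  have "(norm y)\<^sup>2 = (\<Sum>\<alpha>\<in>A. \<Sum>\<beta>\<in>A. s \<alpha> * s \<beta> * inner (x \<alpha>) (x \<beta>))"
    unfolding power2_norm_eq_inner y_def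
    by (simp add: inner_sum_left inner_sum_right sum_distrib_left ac_simps inner_commute)
  also have "\<dots> \<le> (\<Sum>\<alpha>\<in>A. \<Sum>\<beta>\<in>A. (((s \<alpha>)\<^sup>2 + (s \<beta>)\<^sup>2) / 2) * \<bar>inner (x \<alpha>) (x \<beta>)\<bar>)"
  proof (intro sum_mono)
    fix \<alpha> \<beta>
    have "s \<alpha> * s \<beta> * inner (x \<alpha>) (x \<beta>) \<le> \<bar>s \<alpha> * s \<beta>\<bar> * \<bar>inner (x \<alpha>) (x \<beta>)\<bar>"
      by (metis abs_ge_self abs_mult)
    also have "\<dots> \<le> (((s \<alpha>)\<^sup>2 + (s \<beta>)\<^sup>2) / 2) * \<bar>inner (x \<alpha>) (x \<beta>)\<bar>"
      using sum_squares_bound[of "\<bar>s \<alpha>\<bar>" "\<bar>s \<beta>\<bar>"]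
      by (intro mult_right_mono) (auto simp: abs_mult)
    finally show "s \<alpha> * s \<beta> * inner (x \<alpha>) (x \<beta>) \<le> \<dots>" .
  qed
  also have "\<dots> = (\<Sum>\<alpha>\<in>A. \<Sum>\<beta>\<in>A. (s \<alpha>)\<^sup>2 / 2 * \<bar>inner (x \<alpha>) (x \<beta>)\<bar>)
      + (\<Sum>\<alpha>\<in>A. \<Sum>\<beta>\<in>A. (s \<beta>)\<^sup>2 / 2 * \<bar>inner (x \<alpha>) (x \<beta>)\<bar>)"
    by (simp add: sum.distrib[symmetric] algebra_simps add_divide_distrib)
  also have "(\<Sum>\<alpha>\<in>A. \<Sum>\<beta>\<in>A. (s \<beta>)\<^sup>2 / 2 * \<bar>inner (x \<alpha>) (x \<beta>)\<bar>)
      = (\<Sum>\<beta>\<in>A. \<Sum>\<alpha>\<in>A. (s \<beta>)\<^sup>2 / 2 * \<bar>inner (x \<beta>) (x \<alpha>)\<bar>)"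
    by (subst sum.swap) (simp add: inner_commute)
  also have "(\<Sum>\<alpha>\<in>A. \<Sum>\<beta>\<in>A. (s \<alpha>)\<^sup>2 / 2 * \<bar>inner (x \<alpha>) (x \<beta>)\<bar>) + \<dots>
      = (\<Sum>\<alpha>\<in>A. (s \<alpha>)\<^sup>2 * (\<Sum>\<beta>\<in>A. \<bar>inner (x \<alpha>) (x \<beta>)\<bar>))"
    by (simp add: sum_distrib_left sum.distrib[symmetric] mult.commute)
  also have "\<dots> \<le> (\<Sum>\<alpha>\<in>A. (s \<alpha>)\<^sup>2 * L)"
    by (intro sum_mono mult_left_mono row) auto
  also have "\<dots> = L * S"
    by (simp add: S_def sum_distrib_left mult.commute)
  finally have y: "(norm y)\<^sup>2 \<le> L * S" .
  have "S\<^sup>2 \<le> (norm y)\<^sup>2 * (norm q)\<^sup>2"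
    using Cauchy_Schwarz_ineq2[of y q] S0 unfolding yq power_mult_distrib[symmetric]
    by (intro power_mono) auto
  also have "\<dots> \<le> (L * S) * (norm q)\<^sup>2"
    by (intro mult_right_mono y) auto
  finally have "S * S \<le> S * (L * (norm q)\<^sup>2)" by (simp add: power2_eq_square algebra_simps)
  then have "S \<le> L * (norm q)\<^sup>2"
    using S0 \<open>0 \<le> L\<close> by (cases "S = 0") auto
  then show ?thesis by (simp add: S_def s_def)
qed

text \<open>
  The sum on the right is the squared norm of the orthogonal projection of \<open>x\<close> to the span;
  the signum normalises the vectors and lets \<open>0 \<in> C\<close> drop out.
\<close>

lemma norm_square_le_dist_orthogonal_span:
  fixes x :: "'a::real_inner"
  assumes "finite C" "pairwise orthogonal C" "e \<in> span C"
  shows "(norm x)\<^sup>2 \<le> (norm (x - e))\<^sup>2 + (\<Sum>c\<in>C. (inner x (sgn c))\<^sup>2)"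
proof -
  define p where "p = (\<Sum>c\<in>C. inner x (sgn c) *\<^sub>R sgn c)"
  have orth: "inner (sgn c) (sgn c') = 0" if "c \<in> C" "c' \<in> C" "c \<noteq> c'" for c c'
    using assms(2) that by (auto simp: pairwise_def orthogonal_def sgn_div_norm)
  have diag: "inner x (sgn c) * inner (sgn c) (sgn c) = inner x (sgn c)" for c
    by (cases "c = 0") (simp_all add: sgn_div_norm power2_norm_eq_inner[symmetric] power2_eq_square)
  have pc: "inner p (sgn c) = inner x (sgn c)" if "c \<in> C" for c
  proof -
    have "inner p (sgn c) = (\<Sum>c'\<in>C. inner x (sgn c') * inner (sgn c') (sgn c))"
      by (simp add: p_def inner_sum_left)
    also have "\<dots> = (\<Sum>c'\<in>C. if c' = c then inner x (sgn c) else 0)"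
      using orth that diag by (intro sum.cong) auto
    finally show ?thesis using assms(1) that by simp
  qed
  have "orthogonal (x - p) c" if "c \<in> C" for c
  proof (cases "c = 0")
    case False
    have "inner (x - p) (sgn c) = 0" using pc[OF that] by (simp add: inner_diff_left)
    then show ?thesis using False by (simp add: orthogonal_def sgn_div_norm)
  qed (simp add: orthogonal_def)
  moreover have "p - e \<in> span C"
    unfolding p_def sgn_div_norm
    by (intro span_diff assms(3) span_sum span_scale span_base)
  ultimately have o: "orthogonal (x - p) (p - e)"
    by (meson orthogonal_to_span)
  have "(norm (x - e))\<^sup>2 = (norm (x - p))\<^sup>2 + (norm (p - e))\<^sup>2"
    using norm_add_Pythagorean[OF o] by simp
  moreover have "inner p p = (\<Sum>c\<in>C. (inner x (sgn c))\<^sup>2)"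
  proof -
    have "inner p p = (\<Sum>c\<in>C. inner x (sgn c) * inner p (sgn c))"
      by (subst (2) p_def) (simp add: inner_sum_right)
    then show ?thesis by (simp add: pc power2_eq_square)
  qed
  moreover have "inner x p = (\<Sum>c\<in>C. (inner x (sgn c))\<^sup>2)"
    by (simp add: p_def inner_sum_right power2_eq_square)
  moreover have "(norm (x - p))\<^sup>2 = (norm x)\<^sup>2 - 2 * inner x p + inner p p"
    by (simp add: power2_norm_eq_inner inner_diff inner_commute)
  ultimately show ?thesis by simp
qed

text \<open>
  An \<open>n\<close>-dimensional space has an orthonormal basis of at most \<open>n\<close> vectors, and each of them
  captures at most \<open>L\<close> of the total energy \<open>\<Sum>\<alpha>. \<parallel>x \<alpha>\<parallel>\<^sup>2\<close>. Whatever is not captured has to be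
  paid for by the approximation errors. This is the source of the lower bound for the widths.
\<close>

lemma sum_norm_squares_le_of_approx:
  fixes x :: "'i \<Rightarrow> 'a::real_inner"
  assumes "finite A"
    and row: "\<And>\<alpha>. \<alpha> \<in> A \<Longrightarrow> (\<Sum>\<beta>\<in>A. \<bar>inner (x \<alpha>) (x \<beta>)\<bar>) \<le> L"
    and "0 \<le> L"
    and B: "finite B" "card B \<le> n"
    and e: "\<And>\<alpha>. \<alpha> \<in> A \<Longrightarrow> e \<alpha> \<in> span B"
    and close: "\<And>\<alpha>. \<alpha> \<in> A \<Longrightarrow> norm (x \<alpha> - e \<alpha>) \<le> \<eta>"
  shows "(\<Sum>\<alpha>\<in>A. (norm (x \<alpha>))\<^sup>2) \<le> real n * L + real (card A) * \<eta>\<^sup>2"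
proof -
  obtain C where C: "finite C" "card C \<le> card B" "span C = span B" "pairwise orthogonal C"
    using basis_orthogonal[OF B(1)] by blast
  have "(\<Sum>\<alpha>\<in>A. (norm (x \<alpha>))\<^sup>2) \<le> (\<Sum>\<alpha>\<in>A. \<eta>\<^sup>2 + (\<Sum>c\<in>C. (inner (x \<alpha>) (sgn c))\<^sup>2))"
  proof (intro sum_mono)
    fix \<alpha> assume \<alpha>: "\<alpha> \<in> A"
    have "(norm (x \<alpha> - e \<alpha>))\<^sup>2 \<le> \<eta>\<^sup>2" by (intro power_mono close \<alpha>) auto
    moreover have "e \<alpha> \<in> span C" using e[OF \<alpha>] C(3) by simp
    ultimately show "(norm (x \<alpha>))\<^sup>2 \<le> \<eta>\<^sup>2 + (\<Sum>c\<in>C. (inner (x \<alpha>) (sgn c))\<^sup>2)"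
      using norm_square_le_dist_orthogonal_span[OF C(1,4), of "e \<alpha>" "x \<alpha>"] by linarith
  qed
  also have "\<dots> = real (card A) * \<eta>\<^sup>2 + (\<Sum>c\<in>C. \<Sum>\<alpha>\<in>A. (inner (x \<alpha>) (sgn c))\<^sup>2)"
    by (simp add: sum.distrib) (rule sum.swap)
  also have "(\<Sum>c\<in>C. \<Sum>\<alpha>\<in>A. (inner (x \<alpha>) (sgn c))\<^sup>2) \<le> (\<Sum>c\<in>C. L)"
  proof (intro sum_mono)
    fix c :: 'a
    have "L * (norm (sgn c))\<^sup>2 \<le> L" using \<open>0 \<le> L\<close> by (simp add: norm_sgn)
    then show "(\<Sum>\<alpha>\<in>A. (inner (x \<alpha>) (sgn c))\<^sup>2) \<le> L"
      using sum_inner_squares_le[OF assms(1) row \<open>0 \<le> L\<close>, of "sgn c"] by linarith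
  qed
  also have "\<dots> \<le> real n * L"
    using C(2) B(2) \<open>0 \<le> L\<close> by (simp add: mult_right_mono)
  finally show ?thesis by simp
qed

text \<open>
  The infimum over the subspace need not be attained for this argument: a distance
  strictly below \<open>r\<close> already yields an approximant with error below \<open>r\<close>.
\<close>

lemma kolmogorov_width_ge:
  assumes "\<And>B. finite B \<Longrightarrow> card B \<le> n \<Longrightarrow>
    (\<And>u. u \<in> K \<Longrightarrow> \<exists>v\<in>span B. norm (u - v) < r) \<Longrightarrow> False"
  shows "ereal r \<le> kolmogorov_width n K"
  unfolding kolmogorov_width_def
proof (rule INF_greatest, rule ccontr)
  fix E assume E: "E \<in> {E. subspace E \<and> (\<exists>B. finite B \<and> span B = E) \<and> dim E \<le> n}"
    and lt: "\<not> ereal r \<le> subspace_dist K E"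
  obtain B0 where B0: "finite B0" "span B0 = E" using E by auto
  obtain B where B: "B \<subseteq> E" "independent B" "E \<subseteq> span B" "card B = dim E"
    using basis_exists by blast
  have fin: "finite B" using independent_span_bound[OF B0(1) B(2)] B(1) B0(2) by auto
  show False
  proof (rule assms[OF fin])
    show "card B \<le> n" using B(4) E by simp
    fix u assume u: "u \<in> K"
    have "(INF v\<in>E. ereal (norm (u - v))) \<le> subspace_dist K E"
      unfolding subspace_dist_def using u by (rule SUP_upper)
    then have "(INF v\<in>E. ereal (norm (u - v))) < ereal r" using lt by simp
    then obtain v where "v \<in> E" "norm (u - v) < r" by (auto simp: INF_less_iff)
    then show "\<exists>v\<in>span B. norm (u - v) < r" using B(3) by auto
  qed
qed

section \<open>Discs are domains with Hoelder boundary\<close>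

lemma power2_le_iff_le_sqrt:
  fixes a q :: real
  assumes "0 \<le> a"
  shows "a\<^sup>2 \<le> q \<longleftrightarrow> a \<le> sqrt q"
proof
  assume "a \<le> sqrt q"
  then have "0 \<le> q" using assms real_sqrt_ge_0_iff[of q] by linarith
  moreover have "a\<^sup>2 \<le> (sqrt q)\<^sup>2" using \<open>a \<le> sqrt q\<close> assms by (rule power_mono)
  ultimately show "a\<^sup>2 \<le> q" by simp
qed (rule real_le_rsqrt)

text \<open>
  Two-sided derivatives on a neighbourhood of the interval determine the one-sided
  derivatives at its endpoints.
\<close>

lemma interval_deriv_eq:
  assumes "0 < R"
    and F: "\<And>k t. k < n \<Longrightarrow> t \<in> {-R..R} \<Longrightarrow> (F k has_real_derivative F (Suc k) t) (at t)"
    and "F 0 = \<psi>"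
  shows "k \<le> n \<Longrightarrow> t \<in> {-R..R} \<Longrightarrow> interval_deriv R \<psi> k t = F k t"
proof (induction k arbitrary: t)
  case (Suc k)
  have "(F k has_vector_derivative F (Suc k) t) (at t within {-R..R})"
    using F[of k t] Suc.prems
    by (auto simp: has_real_derivative_iff_has_vector_derivative[symmetric] intro: has_field_derivative_at_within)
  then have "(interval_deriv R \<psi> k has_vector_derivative F (Suc k) t) (at t within {-R..R})"
    by (rule has_vector_derivative_transform[rotated 2]) (use Suc in auto)
  then show ?case
    using vector_derivative_within_cbox[of "-R" R t "interval_deriv R \<psi> k"] Suc.prems assms(1) by simp
qed (use assms in auto)

lemma holder_order_bounds:
  assumes "1 \<le> s"
  shows "0 < s - real (holder_order s)" "s - real (holder_order s) \<le> 1"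
proof -
  have "1 \<le> \<lceil>s\<rceil>" using assms by (simp add: one_le_ceiling)
  then have "real (holder_order s) = of_int \<lceil>s\<rceil> - 1"
    by (simp add: holder_order_def)
  then show "0 < s - real (holder_order s)" "s - real (holder_order s) \<le> 1"
    by linarith+
qed

text \<open>
  A bound for one derivative more than the Hoelder order makes the top derivative
  Lipschitz. Since the interval has length at most 1, Lipschitz continuity implies the Hoelder
  condition with every exponent in \<open>(0, 1]\<close>, with the same constant.
\<close>

lemma holder_space_of_derivatives:
  assumes s: "1 \<le> s" and R: "0 < R" "R \<le> 1 / 2"
    and F: "\<And>k t. k \<le> holder_order s \<Longrightarrow> t \<in> {-R..R} \<Longrightarrow>
      (F k has_real_derivative F (Suc k) t) (at t)"
    and F0: "F 0 = \<psi>"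
    and bound: "\<And>k t. k \<le> Suc (holder_order s) \<Longrightarrow> t \<in> {-R..R} \<Longrightarrow> \<bar>F k t\<bar> \<le> C"
  shows "\<psi> \<in> holder_space s R" "holder_norm s R \<psi> \<le> ereal (2 * C)"
proof -
  let ?K = "holder_order s"
  have eq: "interval_deriv R \<psi> k t = F k t" if "k \<le> ?K" "t \<in> {-R..R}" for k t
    using interval_deriv_eq[OF R(1), of "?K" F \<psi> k t] F F0 that by simp
  have C0: "0 \<le> C" using bound[of 0 0] R by (meson abs_ge_zero atLeastAtMost_iff le0 less_imp_le neg_le_0_iff_le order_trans)
  have quot: "\<bar>F ?K a - F ?K b\<bar> / \<bar>a - b\<bar> powr (s - real ?K) \<le> C"
    if ab: "a \<in> {-R..R}" "b \<in> {-R..R}" "a \<noteq> b" for a b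
  proof -
    have "norm (F ?K a - F ?K b) \<le> C * norm (a - b)"
    proof (rule field_differentiable_bound)
      show "convex {-R..R}" by simp
      show "(F ?K has_field_derivative F (Suc ?K) t) (at t within {-R..R})" if "t \<in> {-R..R}" for t
        using F[of ?K t] that by (auto intro: has_field_derivative_at_within)
      show "norm (F (Suc ?K) t) \<le> C" if "t \<in> {-R..R}" for t
        using bound[of "Suc ?K" t] that by simp
    qed (use ab in auto)
    also have "\<dots> \<le> C * \<bar>a - b\<bar> powr (s - real ?K)"
    proof -
      have "\<bar>a - b\<bar> \<le> 1" using ab R by auto
      then have "\<bar>a - b\<bar> powr 1 \<le> \<bar>a - b\<bar> powr (s - real ?K)"
        using holder_order_bounds[OF s] ab by (intro powr_mono') auto
      then show ?thesis using C0 ab by (intro mult_left_mono) auto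
    qed
    finally show ?thesis using ab by (simp add: divide_le_eq)
  qed
  have "holder_norm s R \<psi> \<le> ereal C + ereal C"
    unfolding holder_norm_def
  proof (intro add_mono SUP_least)
    show "ereal \<bar>interval_deriv R \<psi> k t\<bar> \<le> ereal C" if "k \<in> {0..?K}" "t \<in> {-R..R}" for k t
      using that bound[of k t] eq[of k t] by simp
    fix z assume "z \<in> {(a, b). a \<in> {-R..R} \<and> b \<in> {-R..R} \<and> a \<noteq> b}"
    then show "(case z of (a, b) \<Rightarrow> ereal (\<bar>interval_deriv R \<psi> ?K a - interval_deriv R \<psi> ?K b\<bar>
        / \<bar>a - b\<bar> powr (s - real ?K))) \<le> ereal C"
      using eq quot by (auto split: prod.splits)
  qed
  then show norm: "holder_norm s R \<psi> \<le> ereal (2 * C)" by simp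
  have "interval_deriv R \<psi> k differentiable_on {-R..R}" if "k < ?K" for k
    unfolding differentiable_on_def
  proof
    fix t assume t: "t \<in> {-R..R}"
    have "F k differentiable (at t within {-R..R})"
      using F[of k t] that t by (meson less_imp_le real_differentiable_def differentiable_at_withinI)
    then show "interval_deriv R \<psi> k differentiable (at t within {-R..R})"
      by (rule differentiable_transform_within[where d = 1]) (use t that eq in auto)
  qed
  then show "\<psi> \<in> holder_space s R"
    using norm by (auto simp: holder_space_def)
qed

text \<open>
  The derivatives in \<open>z\<close> of the circular arc \<open>sqrt (\<rho> - z\<^sup>2)\<close> are linear combinations of
  \<open>z\<^sup>a (\<rho> - z\<^sup>2)\<^sup>b\<close>. This class is closed under differentiation, and its members are
  continuous in both variables, which makes the bounds below uniform in the squared radius \<open>\<rho>\<close>.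
\<close>

inductive arc_function :: "(real \<Rightarrow> real \<Rightarrow> real) \<Rightarrow> bool" where
  monomial: "arc_function (\<lambda>\<rho> z. c * z ^ a * (\<rho> - z\<^sup>2) powr b)"
| add: "arc_function f \<Longrightarrow> arc_function g \<Longrightarrow> arc_function (\<lambda>\<rho> z. f \<rho> z + g \<rho> z)"

definition arc_range :: "(real \<times> real) set" where
  "arc_range = {1/16..1/8} \<times> {-1/16..1/16}"

lemma arc_range_pos: "(\<rho>, z) \<in> arc_range \<Longrightarrow> 0 < \<rho> - z\<^sup>2"
proof -
  assume "(\<rho>, z) \<in> arc_range"
  then have "\<bar>z\<bar> \<le> 1/16" "1/16 \<le> \<rho>" by (auto simp: arc_range_def)
  then have "z\<^sup>2 \<le> (1/16)\<^sup>2" unfolding abs_le_square_iff[symmetric] by simp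
  then show ?thesis using \<open>1/16 \<le> \<rho>\<close> by (simp add: power2_eq_square)
qed

lemma arc_function_deriv:
  assumes "arc_function f"
  shows "\<exists>g. arc_function g \<and>
    (\<forall>\<rho> z. (\<rho>, z) \<in> arc_range \<longrightarrow> (f \<rho> has_real_derivative g \<rho> z) (at z))"
  using assms
proof induction
  case (monomial c a b)
  let ?g = "\<lambda>\<rho> z. (c * real a) * z ^ (a - 1) * (\<rho> - z\<^sup>2) powr b
    + (- 2 * b * c) * z ^ (a + 1) * (\<rho> - z\<^sup>2) powr (b - 1)"
  show ?case
  proof (intro exI[of _ ?g] conjI allI impI)
    show "arc_function ?g" by (intro arc_function.intros)
    fix \<rho> z assume "(\<rho>, z) \<in> arc_range"
    from arc_range_pos[OF this]
    show "((\<lambda>z. c * z ^ a * (\<rho> - z\<^sup>2) powr b) has_real_derivative ?g \<rho> z) (at z)"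
      by (auto intro!: derivative_eq_intros simp: field_simps powr_diff power_add)
  qed
next
  case (add f g)
  then obtain f' g' where "arc_function f'" "arc_function g'"
    "\<And>\<rho> z. (\<rho>, z) \<in> arc_range \<Longrightarrow> (f \<rho> has_real_derivative f' \<rho> z) (at z)"
    "\<And>\<rho> z. (\<rho>, z) \<in> arc_range \<Longrightarrow> (g \<rho> has_real_derivative g' \<rho> z) (at z)"
    by blast
  then show ?case
    by (intro exI[of _ "\<lambda>\<rho> z. f' \<rho> z + g' \<rho> z"]) (auto intro!: arc_function.intros DERIV_add)
qed

lemma arc_function_bounded:
  assumes "arc_function f"
  shows "\<exists>C. \<forall>\<rho> z. (\<rho>, z) \<in> arc_range \<longrightarrow> \<bar>f \<rho> z\<bar> \<le> C"
proof -
  have "continuous_on arc_range (\<lambda>w. f (fst w) (snd w))"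
    using assms
  proof induction
    case (monomial c a b)
    show ?case
      by (intro continuous_intros) (use arc_range_pos in \<open>force simp: split_paired_all\<close>)
  qed (intro continuous_intros)
  moreover have "compact arc_range" by (simp add: arc_range_def compact_Times)
  ultimately have "bounded ((\<lambda>w. f (fst w) (snd w)) ` arc_range)"
    by (intro compact_imp_bounded compact_continuous_image)
  then obtain C where "\<forall>w\<in>arc_range. \<bar>f (fst w) (snd w)\<bar> \<le> C"
    by (auto simp: bounded_iff)
  then show ?thesis by fastforce
qed

lemma arc_derivatives:
  obtains F :: "nat \<Rightarrow> real \<Rightarrow> real \<Rightarrow> real" and C :: "nat \<Rightarrow> real"
  where "\<And>\<rho> z. (\<rho>, z) \<in> arc_range \<Longrightarrow> F 0 \<rho> z = sqrt (\<rho> - z\<^sup>2)"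
    and "\<And>k \<rho> z. (\<rho>, z) \<in> arc_range \<Longrightarrow> (F k \<rho> has_real_derivative F (Suc k) \<rho> z) (at z)"
    and "\<And>k \<rho> z. (\<rho>, z) \<in> arc_range \<Longrightarrow> \<bar>F k \<rho> z\<bar> \<le> C k"
proof -
  let ?f0 = "\<lambda>\<rho> z::real. 1 * z ^ 0 * (\<rho> - z\<^sup>2) powr (1/2)"
  have "\<exists>F. \<forall>k. (arc_function (F k) \<and> (k = 0 \<longrightarrow> F k = ?f0)) \<and>
    (\<forall>\<rho> z. (\<rho>, z) \<in> arc_range \<longrightarrow> (F k \<rho> has_real_derivative F (Suc k) \<rho> z) (at z))"
  proof (rule dependent_nat_choice)
    show "\<exists>f. arc_function f \<and> (0 = (0::nat) \<longrightarrow> f = ?f0)"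
      using arc_function.monomial by blast
    fix f and k :: nat assume "arc_function f \<and> (k = 0 \<longrightarrow> f = ?f0)"
    then show "\<exists>g. (arc_function g \<and> (Suc k = 0 \<longrightarrow> g = ?f0)) \<and>
      (\<forall>\<rho> z. (\<rho>, z) \<in> arc_range \<longrightarrow> (f \<rho> has_real_derivative g \<rho> z) (at z))"
      using arc_function_deriv by blast
  qed
  then obtain F where F: "\<And>k. arc_function (F k)" "F 0 = ?f0"
    "\<And>k \<rho> z. (\<rho>, z) \<in> arc_range \<Longrightarrow> (F k \<rho> has_real_derivative F (Suc k) \<rho> z) (at z)"
    by blast
  have "\<forall>k. \<exists>C. \<forall>\<rho> z. (\<rho>, z) \<in> arc_range \<longrightarrow> \<bar>F k \<rho> z\<bar> \<le> C"
    using arc_function_bounded[OF F(1)] by blast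
  then obtain C where C: "\<And>k \<rho> z. (\<rho>, z) \<in> arc_range \<Longrightarrow> \<bar>F k \<rho> z\<bar> \<le> C k"
    by metis
  show ?thesis
  proof
    fix \<rho> z assume "(\<rho>, z) \<in> arc_range"
    from arc_range_pos[OF this] show "F 0 \<rho> z = sqrt (\<rho> - z\<^sup>2)"
      by (simp add: F(2) powr_half_sqrt)
  qed (use F C in auto)
qed

definition disc :: "real \<times> real \<Rightarrow> real \<Rightarrow> (real \<times> real) set" where
  "disc c \<rho> = {z. (norm (z - c))\<^sup>2 \<le> \<rho>}"

text \<open>
  Let \<open>D\<close> be the distance of \<open>x\<close> from the centre. If \<open>D \<ge> R\<close>, take \<open>e2\<close> to be the radial direction:
  no point of the box lies behind the centre, so only the outer arc matters, and the disc is the subgraph of \<open>sqrt (\<rho> - z\<^sup>2) - D\<close>. If \<open>D < R\<close>, the whole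
  box lies inside the disc, whose radius is at least 1/4, and the constant \<open>1 > R\<close> serves as graph.
  Only the additive constant depends on \<open>x\<close>, so one bound \<open>M0\<close> serves all charts, all radii and all \<open>R\<close>.
\<close>

lemma holder_domain_disc:
  assumes s: "1 \<le> s"
  obtains M0 where "0 < M0"
    and "\<And>R M \<rho> c. 0 < R \<Longrightarrow> R \<le> 1/16 \<Longrightarrow> M0 \<le> M \<Longrightarrow> \<rho> \<in> {1/16..1/8} \<Longrightarrow>
      c \<in> {1/2..17/32} \<times> {1/2} \<Longrightarrow> holder_domain s R M (disc c \<rho>)"
proof -
  obtain F C where F0: "\<And>\<rho> z. (\<rho>, z) \<in> arc_range \<Longrightarrow> F 0 \<rho> z = sqrt (\<rho> - z\<^sup>2)"
    and F: "\<And>k \<rho> z. (\<rho>, z) \<in> arc_range \<Longrightarrow> (F k \<rho> has_real_derivative F (Suc k) \<rho> z) (at z)"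
    and C: "\<And>k \<rho> z. (\<rho>, z) \<in> arc_range \<Longrightarrow> \<bar>F k \<rho> z\<bar> \<le> C k"
    using arc_derivatives by blast
  define B where "B = (\<Sum>k\<le>Suc (holder_order s). \<bar>C k\<bar>) + 2"
  have B2: "2 \<le> B" by (simp add: B_def sum_nonneg)
  have CB: "C k + 2 \<le> B" if "k \<le> Suc (holder_order s)" for k
  proof -
    have "\<bar>C k\<bar> \<le> (\<Sum>k\<le>Suc (holder_order s). \<bar>C k\<bar>)"
      using that by (intro member_le_sum) auto
    then show ?thesis by (simp add: B_def)
  qed
  show ?thesis
  proof
    show "0 < 2 * B" using B2 by simp
    fix R M \<rho> :: real and c :: "real \<times> real"
    assume R: "0 < R" "R \<le> 1/16" and M: "2 * B \<le> M" and \<rho>: "\<rho> \<in> {1/16..1/8}"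
      and c: "c \<in> {1/2..17/32} \<times> {1/2}"
    have c': "1/2 \<le> fst c" "fst c \<le> 17/32" "snd c = 1/2" using c by auto
    have range: "(\<rho>, z) \<in> arc_range" if "\<bar>z\<bar> \<le> R" for z
      using that R \<rho> by (auto simp: arc_range_def)
    have sub: "disc c \<rho> \<subseteq> {R..1 - R} \<times> {R..1 - R}"
    proof
      fix z assume "z \<in> disc c \<rho>"
      then have "(fst z - fst c)\<^sup>2 + (snd z - snd c)\<^sup>2 \<le> 1/8"
        using \<rho> by (simp add: disc_def norm_prod_def)
      then have "(fst z - fst c)\<^sup>2 \<le> (3/8)\<^sup>2" "(snd z - snd c)\<^sup>2 \<le> (3/8)\<^sup>2"
        using zero_le_power2[of "fst z - fst c"] zero_le_power2[of "snd z - snd c"]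
        unfolding power2_eq_square[of "3/8"] by linarith+
      then have "\<bar>fst z - fst c\<bar> \<le> 3/8" "\<bar>snd z - snd c\<bar> \<le> 3/8"
        unfolding abs_le_square_iff[symmetric] by simp_all
      then show "z \<in> {R..1 - R} \<times> {R..1 - R}"
        using c' R unfolding mem_Times_iff atLeastAtMost_iff abs_le_iff by linarith
    qed
    show "holder_domain s R M (disc c \<rho>)"
      unfolding holder_domain_def
    proof (intro conjI sub ballI)
      fix x assume x: "x \<in> unit_square"
      define D where "D = norm (x - c)"
      show "\<exists>e1 e2 \<psi>. norm e1 = 1 \<and> norm e2 = 1 \<and> inner e1 e2 = 0 \<and>
        \<psi> \<in> holder_space s R \<and> holder_norm s R \<psi> \<le> ereal M \<and>
        (\<forall>z1 z2. \<bar>z1\<bar> \<le> R \<and> \<bar>z2\<bar> \<le> R \<longrightarrow>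
          (x + z1 *\<^sub>R e1 + z2 *\<^sub>R e2 \<in> disc c \<rho> \<longleftrightarrow> z2 \<le> \<psi> z1))"
      proof (cases "D < R")
        case True
        let ?F = "\<lambda>k::nat. \<lambda>_::real. if k = 0 then 1 else 0 :: real"
        have 1: "(\<lambda>_. 1) \<in> holder_space s R" "holder_norm s R (\<lambda>_. 1) \<le> ereal (2 * 1)"
          using holder_space_of_derivatives[of s R ?F "\<lambda>_. 1" 1] s R by auto
        have "x + z1 *\<^sub>R (1, 0) + z2 *\<^sub>R (0, 1) \<in> disc c \<rho>" if "\<bar>z1\<bar> \<le> R" "\<bar>z2\<bar> \<le> R" for z1 z2
        proof -
          have "norm (x + z1 *\<^sub>R (1, 0) + z2 *\<^sub>R (0, 1) - c)
            \<le> norm (x - c) + norm (z1 *\<^sub>R (1::real, 0::real)) + norm (z2 *\<^sub>R (0::real, 1::real))"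
            by (metis (no_types, lifting) add_diff_eq diff_add_eq norm_triangle_mono norm_triangle_ineq order_refl)
          also have "\<dots> \<le> 1/4" using True that R by (simp add: D_def norm_prod_def)
          finally have "(norm (x + z1 *\<^sub>R (1, 0) + z2 *\<^sub>R (0, 1) - c))\<^sup>2 \<le> (1/4)\<^sup>2"
            by (intro power_mono) auto
          then show ?thesis using \<rho> by (simp add: disc_def power2_eq_square)
        qed
        moreover have "ereal (2 * 1) \<le> ereal M" using M B2 by simp
        ultimately show ?thesis
          using 1 R by (intro exI[of _ "(1, 0)"] exI[of _ "(0, 1)"] exI[of _ "\<lambda>_. 1"])
            (auto simp: norm_prod_def intro: order_trans)
      next
        case False
        define e2 where "e2 = (1 / D) *\<^sub>R (x - c)"
        define e1 where "e1 = (- snd e2, fst e2)"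
        define \<psi> where "\<psi> z = F 0 \<rho> z - D" for z
        have D: "0 < D" using False R by simp
        have e2: "norm e2 = 1" using D by (simp add: e2_def D_def)
        have e: "norm e1 = 1" "inner e1 e2 = 0"
          using e2 by (simp_all add: e1_def norm_prod_def inner_prod_def add.commute)
        have xc: "x - c = D *\<^sub>R e2" using D by (simp add: e2_def)
        have D2: "D \<le> 2"
        proof -
          have "norm (x - c) \<le> \<bar>fst (x - c)\<bar> + \<bar>snd (x - c)\<bar>"
            using norm_Pair_le[of "fst (x - c)" "snd (x - c)"] unfolding prod.collapse by simp
          also have "\<dots> \<le> 2" using x c' by (auto simp: unit_square_def)
          finally show ?thesis by (simp add: D_def)
        qed
        let ?F = "\<lambda>k z. if k = 0 then F 0 \<rho> z - D else F k \<rho> z"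
        have der: "(?F k has_real_derivative ?F (Suc k) t) (at t)" if "t \<in> {-R..R}" for k t
          using F[OF range, of t k] that by (cases "k = 0") (auto intro!: derivative_eq_intros)
        have bd: "\<bar>?F k t\<bar> \<le> B" if "k \<le> Suc (holder_order s)" "t \<in> {-R..R}" for k t
        proof -
          have "\<bar>F k \<rho> t\<bar> + 2 \<le> B"
            using C[OF range, of t k] CB[OF that(1)] that(2) by (auto simp: abs_le_iff[of t])
          then show ?thesis using D D2 by (cases "k = 0") auto
        qed
        have "\<psi> \<in> holder_space s R" "holder_norm s R \<psi> \<le> ereal (2 * B)"
          using holder_space_of_derivatives[of s R ?F \<psi> B, OF s R(1) _ der _ bd] R
          by (simp_all add: \<psi>_def fun_eq_iff)
        moreover have "x + z1 *\<^sub>R e1 + z2 *\<^sub>R e2 \<in> disc c \<rho> \<longleftrightarrow> z2 \<le> \<psi> z1"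
          if z: "\<bar>z1\<bar> \<le> R" "\<bar>z2\<bar> \<le> R" for z1 z2
        proof -
          have decomp: "x + z1 *\<^sub>R e1 + z2 *\<^sub>R e2 - c = z1 *\<^sub>R e1 + (D + z2) *\<^sub>R e2"
            using xc by (simp add: algebra_simps)
          have norm: "(norm (z1 *\<^sub>R e1 + (D + z2) *\<^sub>R e2))\<^sup>2 = z1\<^sup>2 + (D + z2)\<^sup>2"
            using e e2 unfolding power2_norm_eq_inner
            by (simp add: inner_add inner_commute norm_eq_1 power2_eq_square)
          have "x + z1 *\<^sub>R e1 + z2 *\<^sub>R e2 \<in> disc c \<rho> \<longleftrightarrow> (D + z2)\<^sup>2 \<le> \<rho> - z1\<^sup>2"
            unfolding disc_def mem_Collect_eq decomp norm by auto
          also have "\<dots> \<longleftrightarrow> D + z2 \<le> sqrt (\<rho> - z1\<^sup>2)"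
            using z False by (intro power2_le_iff_le_sqrt) auto
          finally show ?thesis using F0[OF range[OF z(1)]] by (auto simp: \<psi>_def)
        qed
        ultimately show ?thesis
          using e e2 M by (intro exI[of _ e1] exI[of _ e2] exI[of _ \<psi>])
            (auto intro: order_trans)
      qed
    qed
  qed
qed

section \<open>A weight that turns circles into lines\<close>

definition window :: "(real \<times> real) set" where
  "window = {1/2..3/4} \<times> {1/2..1}"

text \<open>
  On the window, the substitution \<open>Y = (x - 1/2)\<^sup>2 + (y - 1/2)\<^sup>2\<close> has \<open>dY = 2 (y - 1/2) dy\<close> for fixed \<open>x\<close>,
  and a disc centred on the line \<open>y = 1/2\<close> becomes a half-plane \<open>Y \<le> a x + b\<close>. The square root
  supplies this Jacobian in inner products. The first factor vanishes at both ends of the \<open>x\<close>-range;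
  squared, it becomes a weight with double zeros there, as needed for integrating by parts twice.
\<close>

definition window_weight :: "real \<times> real \<Rightarrow> real" where
  "window_weight z = indicator window z * ((fst z - 1/2) * (3/4 - fst z)) * sqrt (2 * (snd z - 1/2))"

lemma window_weight_bounds: "0 \<le> window_weight z" "window_weight z \<le> 1"
proof -
  have "0 \<le> window_weight z \<and> window_weight z \<le> 1"
  proof (cases "z \<in> window")
    case True
    then have z: "1/2 \<le> fst z" "fst z \<le> 3/4" "1/2 \<le> snd z" "snd z \<le> 1"
      by (auto simp: window_def)
    have "(fst z - 1/2) * (3/4 - fst z) * sqrt (2 * (snd z - 1/2)) \<le> 1 * 1 * 1"
      using z by (intro mult_mono) auto
    then show ?thesis using z True by (simp add: window_weight_def)
  qed (simp add: window_weight_def)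
  then show "0 \<le> window_weight z" "window_weight z \<le> 1" by auto
qed

lemma window_weight_measurable: "window_weight \<in> borel_measurable borel"
proof -
  have "window \<in> sets borel" unfolding window_def by (intro borel_closed closed_Times) auto
  then show ?thesis unfolding window_weight_def
    by (intro borel_measurable_times borel_measurable_indicator borel_measurable_continuous_onI continuous_intros)
qed

lemma window_weight_measurable':
  "window_weight \<in> borel_measurable (lebesgue_on unit_square)"
  by (intro measurable_restrict_space1 measurable_completion)
    (simp add: window_weight_measurable)

lemma window_weight_square_le: "(window_weight z * a)\<^sup>2 \<le> a\<^sup>2"
proof -
  have "\<bar>window_weight z * a\<bar> \<le> 1 * \<bar>a\<bar>"
    unfolding abs_mult using window_weight_bounds[of z] by (intro mult_right_mono) auto
  then show ?thesis unfolding abs_le_square_iff[symmetric] by simp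
qed

lemma square_integrable_window_weight:
  assumes "square_integrable_on_square f"
  shows "square_integrable_on_square (\<lambda>z. window_weight z * f z)"
  unfolding square_integrable_on_square_def
proof
  show meas: "(\<lambda>z. window_weight z * f z) \<in> borel_measurable (lebesgue_on unit_square)"
    using assms window_weight_measurable' by (auto simp: square_integrable_on_square_def)
  show "integrable (lebesgue_on unit_square) (\<lambda>z. (window_weight z * f z)\<^sup>2)"
  proof (rule Bochner_Integration.integrable_bound)
    show "integrable (lebesgue_on unit_square) (\<lambda>z. (f z)\<^sup>2)"
      using assms by (simp add: square_integrable_on_square_def)
    show "(\<lambda>z. (window_weight z * f z)\<^sup>2) \<in> borel_measurable (lebesgue_on unit_square)"
      using meas by (rule borel_measurable_power)
    show "AE z in lebesgue_on unit_square. norm ((window_weight z * f z)\<^sup>2) \<le> norm ((f z)\<^sup>2)"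
      by (intro AE_I2) (simp add: window_weight_square_le)
  qed
qed

lift_definition window_mult :: "L2_square \<Rightarrow> L2_square" is "\<lambda>f z. window_weight z * f z"
  by (auto simp: ae_equal_on_square_def intro: square_integrable_window_weight)

lemma linear_window_mult: "linear window_mult"
proof (rule linearI)
  fix u v :: L2_square and c :: real
  show "window_mult (u + v) = window_mult u + window_mult v"
    by transfer (auto simp: ae_equal_on_square_def distrib_left
      intro!: square_integrable_on_square_add square_integrable_window_weight)
  show "window_mult (c *\<^sub>R u) = c *\<^sub>R window_mult u"
    by transfer (auto simp: ae_equal_on_square_def mult.left_commute
      intro!: square_integrable_on_square_scale square_integrable_window_weight)
qed

lemma norm_window_mult_le: "norm (window_mult u) \<le> norm u"
proof -
  have "inner (window_mult u) (window_mult u) \<le> inner u u"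
  proof transfer
    fix f assume "ae_equal_on_square f f"
    then have f: "square_integrable_on_square f" by (simp add: ae_equal_on_square_def)
    note g = square_integrable_window_weight[OF f]
    show "integral\<^sup>L (lebesgue_on unit_square) (\<lambda>z. window_weight z * f z * (window_weight z * f z))
      \<le> integral\<^sup>L (lebesgue_on unit_square) (\<lambda>z. f z * f z)"
      by (intro integral_mono square_integrable_on_square_prod f g)
        (use window_weight_square_le in \<open>auto simp: power2_eq_square\<close>)
  qed
  then show ?thesis by (simp add: norm_eq_sqrt_inner)
qed

text \<open>
  Fubini's theorem; by the choice of the weight, the inner integral over
  \<open>1/2 \<le> y \<le> 1/2 + sqrt (h x - (x - 1/2)\<^sup>2)\<close> is exactly \<open>h x - (x - 1/2)\<^sup>2\<close>, up to the factor that
  depends on \<open>x\<close> only. The two bounds on \<open>h\<close> say that this interval is well defined and stays in the window.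
\<close>

lemma inner_window_mult_indicator:
  assumes sq: "square_integrable_on_square (indicat_real S)" "square_integrable_on_square (indicat_real T)"
    and h: "continuous_on UNIV h" "\<And>x. x \<in> {1/2..3/4} \<Longrightarrow> (x - 1/2)\<^sup>2 \<le> h x"
      "\<And>x. x \<in> {1/2..3/4} \<Longrightarrow> h x \<le> 1/4"
    and ST: "\<And>z. z \<in> window \<Longrightarrow>
      z \<in> S \<inter> T \<longleftrightarrow> (fst z - 1/2)\<^sup>2 + (snd z - 1/2)\<^sup>2 \<le> h (fst z)"
  shows "inner (window_mult (abs_L2_square (indicat_real S))) (window_mult (abs_L2_square (indicat_real T)))
    = integral {1/2..3/4} (\<lambda>x. ((x - 1/2) * (3/4 - x))\<^sup>2 * (h x - (x - 1/2)\<^sup>2))"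
proof -
  define A where "A = {z \<in> window. (fst z - 1/2)\<^sup>2 + (snd z - 1/2)\<^sup>2 \<le> h (fst z)}"
  define p where "p z = ((fst z - 1/2) * (3/4 - fst z))\<^sup>2 * (2 * (snd z - 1/2))" for z :: "real \<times> real"
  have "compact A"
  proof -
    have "A = window \<inter> {z. (fst z - 1/2)\<^sup>2 + (snd z - 1/2)\<^sup>2 \<le> h (fst z)}" by (auto simp: A_def)
    moreover have "continuous_on UNIV (\<lambda>z::real \<times> real. h (fst z))"
      by (rule continuous_on_compose2[OF h(1)]) (auto intro: continuous_intros)
    then have "closed {z::real \<times> real. (fst z - 1/2)\<^sup>2 + (snd z - 1/2)\<^sup>2 \<le> h (fst z)}"
      by (intro closed_Collect_le continuous_intros)
    moreover have "compact window" by (simp add: window_def compact_Times)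
    ultimately show ?thesis by (simp add: compact_Int_closed)
  qed
  then have int: "integrable lborel (\<lambda>z. indicat_real A z *\<^sub>R p z)"
    unfolding p_def by (intro borel_integrable_compact continuous_intros)
  let ?v = "\<lambda>x::real. ((x - 1/2) * (3/4 - x))\<^sup>2"
  let ?b = "\<lambda>x. 1/2 + sqrt (h x - (x - 1/2)\<^sup>2)"
  have ae: "ae_equal_on_square (indicat_real S) (indicat_real S)"
    "ae_equal_on_square (indicat_real T) (indicat_real T)"
    using sq by (auto simp: ae_equal_on_square_def)
  have ae': "ae_equal_on_square (\<lambda>z. window_weight z * indicat_real S z) (\<lambda>z. window_weight z * indicat_real S z)"
    "ae_equal_on_square (\<lambda>z. window_weight z * indicat_real T z) (\<lambda>z. window_weight z * indicat_real T z)"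
    using sq square_integrable_window_weight by (auto simp: ae_equal_on_square_def)
  have "inner (window_mult (abs_L2_square (indicat_real S))) (window_mult (abs_L2_square (indicat_real T)))
    = integral\<^sup>L (lebesgue_on unit_square)
        (\<lambda>z. window_weight z * indicat_real S z * (window_weight z * indicat_real T z))"
    by (simp add: window_mult.abs_eq ae inner_L2_square.abs_eq ae')
  also have "\<dots> = integral\<^sup>L lebesgue (\<lambda>z. indicat_real unit_square z *\<^sub>R
        (window_weight z * indicat_real S z * (window_weight z * indicat_real T z)))"
    by (rule integral_restrict_space) (simp add: unit_square_def borel_closed closed_Times)
  also have "\<dots> = integral\<^sup>L lebesgue (\<lambda>z. indicat_real A z *\<^sub>R p z)"
  proof (intro Bochner_Integration.integral_cong refl)
    fix z
    show "indicat_real unit_square z *\<^sub>R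
        (window_weight z * indicat_real S z * (window_weight z * indicat_real T z)) = indicat_real A z *\<^sub>R p z"
    proof (cases "z \<in> window")
      case True
      then have "z \<in> unit_square" "0 \<le> 2 * (snd z - 1/2)"
        by (auto simp: window_def unit_square_def)
      moreover have "(window_weight z)\<^sup>2 = p z"
        using True calculation by (simp add: window_weight_def p_def power_mult_distrib)
      ultimately have "window_weight z * window_weight z = p z" "z \<in> unit_square"
        by (simp_all add: power2_eq_square)
      then show ?thesis using ST[OF True] True
        by (auto simp: indicator_def A_def)
    qed (simp add: window_weight_def A_def)
  qed
  also have "\<dots> = integral\<^sup>L lborel (\<lambda>z. indicat_real A z *\<^sub>R p z)"
    by (rule integral_completion) (rule borel_measurable_integrable[OF int])
  also have "\<dots> = (\<integral>x. (\<integral>y. indicat_real A (x, y) *\<^sub>R p (x, y) \<partial>lborel) \<partial>lborel)"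
    using lborel_pair.integral_fst'[of "\<lambda>z. indicat_real A z *\<^sub>R p z"] int
    by (simp add: lborel_prod)
  also have "\<dots> = (\<integral>x. indicat_real {1/2..3/4} x *\<^sub>R (?v x * (h x - (x - 1/2)\<^sup>2)) \<partial>lborel)"
  proof (intro Bochner_Integration.integral_cong refl)
    fix x :: real
    show "(\<integral>y. indicat_real A (x, y) *\<^sub>R p (x, y) \<partial>lborel)
      = indicat_real {1/2..3/4} x *\<^sub>R (?v x * (h x - (x - 1/2)\<^sup>2))"
    proof (cases "x \<in> {1/2..3/4}")
      case True
      note hx = h(2,3)[OF True]
      have "sqrt (h x - (x - 1/2)\<^sup>2) \<le> 1/2"
      proof -
        have "h x - (x - 1/2)\<^sup>2 \<le> (1/2)\<^sup>2"
          using hx zero_le_power2[of "x - 1/2"] unfolding power2_eq_square[of "1/2"] by linarith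
        from real_sqrt_le_mono[OF this] show ?thesis by simp
      qed
      moreover have "(x - 1/2)\<^sup>2 + (y - 1/2)\<^sup>2 \<le> h x \<longleftrightarrow> y - 1/2 \<le> sqrt (h x - (x - 1/2)\<^sup>2)"
        if "1/2 \<le> y" for y
        unfolding add.commute[of "(x - 1/2)\<^sup>2"] le_diff_eq[symmetric]
        using that by (intro power2_le_iff_le_sqrt) auto
      ultimately have A: "(x, y) \<in> A \<longleftrightarrow> y \<in> {1/2..?b x}" for y
        using True unfolding A_def window_def
        by (cases "1/2 \<le> y") auto
      have "(\<integral>y. indicat_real A (x, y) *\<^sub>R p (x, y) \<partial>lborel)
        = (\<integral>y. (?v x * (2 * (y - 1/2))) * indicat_real {1/2..?b x} y \<partial>lborel)"
        by (intro Bochner_Integration.integral_cong refl) (auto simp: indicator_def A p_def)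
      also have "\<dots> = ?v x * (?b x - 1/2)\<^sup>2 - ?v x * (1/2 - 1/2)\<^sup>2"
        by (rule integral_FTC_Icc_real) (use hx in \<open>auto intro!: derivative_eq_intros\<close>)
      also have "\<dots> = ?v x * (h x - (x - 1/2)\<^sup>2)" using hx by simp
      finally show ?thesis using True by simp
    next
      case False
      then have "(x, y) \<notin> A" for y by (auto simp: A_def window_def)
      then show ?thesis using False by (simp add: indicator_def)
    qed
  qed
  also have "\<dots> = integral {1/2..3/4} (\<lambda>x. ?v x * (h x - (x - 1/2)\<^sup>2))"
  proof -
    have "set_integrable lborel {1/2..3/4} (\<lambda>x. ?v x * (h x - (x - 1/2)\<^sup>2))"
      using continuous_on_subset[OF h(1) subset_UNIV]
      by (intro borel_integrable_atLeastAtMost' continuous_intros) auto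
    from set_borel_integral_eq_integral(2)[OF this] show ?thesis
      by (simp add: set_lebesgue_integral_def)
  qed
  finally show ?thesis .
qed

section \<open>Fourth differences of ramp integrals\<close>

text \<open>
  The central fourth difference with step 1. It is the autocorrelation of the second difference
  \<open>(1, -2, 1)\<close>, hence appears in inner products of second differences.
\<close>

definition diff4 :: "(real \<Rightarrow> real) \<Rightarrow> real \<Rightarrow> real" where
  "diff4 F t = F (t - 2) - 4 * F (t - 1) + 6 * F t - 4 * F (t + 1) + F (t + 2)"

abbreviation pos_part :: "real \<Rightarrow> real" where
  "pos_part t \<equiv> max 0 t"

text \<open>
  Away from the kink the truncated power is a polynomial of degree less than 4 on all five
  nodes: the fourth difference is a B-spline with compact support.
\<close>

lemma diff4_pos_part_power_eq_0:
  assumes "2 \<le> \<bar>t\<bar>" "p \<in> {1, 3}"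
  shows "diff4 (\<lambda>t. pos_part t ^ p) t = 0"
proof (cases "0 \<le> t")
  case True
  then have "pos_part (t - 2) = t - 2" "pos_part (t - 1) = t - 1" "pos_part t = t"
    "pos_part (t + 1) = t + 1" "pos_part (t + 2) = t + 2"
    using assms(1) by auto
  then show ?thesis using assms(2) unfolding diff4_def
    by (auto simp: power3_eq_cube algebra_simps)
next
  case False
  then have "pos_part (t - 2) = 0" "pos_part (t - 1) = 0" "pos_part t = 0"
    "pos_part (t + 1) = 0" "pos_part (t + 2) = 0"
    using assms(1) by auto
  then show ?thesis using assms(2) unfolding diff4_def by auto
qed

lemma abs_diff4_le:
  assumes "\<And>s. s \<le> 4 \<Longrightarrow> 0 \<le> F s" "\<And>s. s \<le> 4 \<Longrightarrow> F s \<le> K" "t \<le> 2"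
  shows "\<bar>diff4 F t\<bar> \<le> 8 * K"
  using assms(1,2)[of "t - 2"] assms(1,2)[of "t - 1"] assms(1,2)[of t]
    assms(1,2)[of "t + 1"] assms(1,2)[of "t + 2"] assms(3)
  unfolding diff4_def by linarith

lemma abs_diff4_pos_part_power_le:
  assumes "p \<in> {1, 3}"
  shows "\<bar>diff4 (\<lambda>t. pos_part t ^ p) t\<bar> \<le> 512"
proof (cases "2 \<le> \<bar>t\<bar>")
  case False
  have "pos_part s ^ p \<le> 64" if "s \<le> 4" for s
  proof -
    have "pos_part s ^ p \<le> 4 ^ p" using that by (intro power_mono) auto
    then show ?thesis using assms by auto
  qed
  then show ?thesis
    using abs_diff4_le[of "\<lambda>t. pos_part t ^ p" 64 t] False by simp
qed (use assms diff4_pos_part_power_eq_0 in auto)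

text \<open>
  At most four integers lie in an open interval of length 4.
\<close>

lemma sum_lattice_translates_le:
  fixes F :: "real \<Rightarrow> real"
  assumes zero: "\<And>t. 2 \<le> \<bar>t\<bar> \<Longrightarrow> F t = 0" and bound: "\<And>t. \<bar>F t\<bar> \<le> K"
  shows "(\<Sum>l<N. \<bar>F (t - real l)\<bar>) \<le> 4 * K"
proof -
  let ?I = "{l\<in>{..<N}. \<bar>t - real l\<bar> < 2}"
  have K: "0 \<le> K" using bound[of 0] by linarith
  have "int ` ?I \<subseteq> {\<lfloor>t\<rfloor> - 1..\<lfloor>t\<rfloor> + 2}"
    by auto linarith+
  then have "card (int ` ?I) \<le> card {\<lfloor>t\<rfloor> - 1..\<lfloor>t\<rfloor> + 2}"
    by (intro card_mono) auto
  then have card: "card ?I \<le> 4" by (simp add: card_image)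
  have "(\<Sum>l<N. \<bar>F (t - real l)\<bar>) = (\<Sum>l\<in>?I. \<bar>F (t - real l)\<bar>)"
  proof (rule sum.mono_neutral_right)
    show "\<forall>l\<in>{..<N} - ?I. \<bar>F (t - real l)\<bar> = 0"
      using zero by (auto simp flip: not_less)
  qed auto
  also have "\<dots> \<le> (\<Sum>l\<in>?I. K)" by (intro sum_mono bound)
  also have "\<dots> \<le> 4 * K" using card K by (simp add: mult_right_mono)
  finally show ?thesis .
qed

lemma has_derivative_pos_part_power:
  "((\<lambda>t. pos_part t ^ Suc (Suc n)) has_real_derivative real (Suc (Suc n)) * pos_part t ^ Suc n) (at t)"
proof -
  consider "t < 0" | "t = 0" | "0 < t" by linarith
  then show ?thesis
  proof cases
    case 1
    have "((\<lambda>t. 0) has_real_derivative 0) (at t)" by simp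
    then have "((\<lambda>t. pos_part t ^ Suc (Suc n)) has_real_derivative 0) (at t)"
      by (rule has_field_derivative_transform_within_open[where S = "{..<0}"]) (use 1 in auto)
    then show ?thesis using 1 by simp
  next
    case 3
    have "((\<lambda>t. t ^ Suc (Suc n)) has_real_derivative real (Suc (Suc n)) * t ^ Suc n) (at t)"
      using DERIV_pow[of "Suc (Suc n)" t] by simp
    then have "((\<lambda>t. pos_part t ^ Suc (Suc n)) has_real_derivative real (Suc (Suc n)) * t ^ Suc n) (at t)"
      by (rule has_field_derivative_transform_within_open[where S = "{0<..}"]) (use 3 in auto)
    then show ?thesis using 3 by simp
  next
    case 2
    have "((\<lambda>h::real. pos_part h ^ Suc n) \<longlongrightarrow> pos_part 0 ^ Suc n) (at 0)"
      by (intro tendsto_intros)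
    moreover have "pos_part h ^ Suc n = (pos_part (0 + h) ^ Suc (Suc n) - pos_part 0 ^ Suc (Suc n)) / h"
      if "h \<noteq> 0" for h :: real
      using that by (cases "0 < h") auto
    ultimately have "((\<lambda>h. (pos_part (0 + h) ^ Suc (Suc n) - pos_part 0 ^ Suc (Suc n)) / h) \<longlongrightarrow> 0) (at 0)"
      by (subst tendsto_cong[where g = "\<lambda>h. pos_part h ^ Suc n"])
        (auto simp: eventually_at_filter)
    then show ?thesis using 2 by (simp add: DERIV_def)
  qed
qed

definition bump :: "real \<Rightarrow> real" where
  "bump x = ((x - 1/2) * (3/4 - x))\<^sup>2"

text \<open>The second derivative of the bump.\<close>

definition bump2 :: "real \<Rightarrow> real" where
  "bump2 x = 2 * ((3/4 - x) - (x - 1/2))\<^sup>2 - 4 * ((x - 1/2) * (3/4 - x))"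

lemma continuous_bump [continuous_intros]: "continuous_on S bump" "continuous_on S bump2"
  unfolding bump_def bump2_def by (intro continuous_intros)+

lemma abs_bump2_le: "x \<in> {1/2..3/4} \<Longrightarrow> \<bar>bump2 x\<bar> \<le> 1"
proof -
  assume x: "x \<in> {1/2..3/4}"
  have "((3/4 - x) - (x - 1/2))\<^sup>2 \<le> (1/4)\<^sup>2"
    unfolding abs_le_square_iff[symmetric] using x unfolding atLeastAtMost_iff by linarith
  moreover have "(x - 1/2) * (3/4 - x) \<le> (1/4) * (1/4)" "0 \<le> (x - 1/2) * (3/4 - x)"
    using x by (intro mult_mono mult_nonneg_nonneg; simp)+
  ultimately show ?thesis
    using zero_le_power2[of "(3/4 - x) - (x - 1/2)"]
    unfolding bump2_def power2_eq_square[of "1/4"] by linarith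
qed

text \<open>
  The part of the inner product of two half-planes \<open>Y \<le> p\<close> and \<open>Y \<le> q\<close> that depends on both of them:
  since \<open>min p q = p - pos_part (p - q)\<close>, two lines whose slopes differ by \<open>k\<close> and whose
  heights differ by \<open>d\<close> interact through \<open>ramp_integral k d\<close>.
\<close>

definition ramp_integral :: "real \<Rightarrow> real \<Rightarrow> real" where
  "ramp_integral k d = integral {1/2..3/4} (\<lambda>x. bump x * pos_part (k * x + d))"

text \<open>
  Two integrations by parts, written as one application of the fundamental theorem to
  \<open>bump q\<^sup>2 / (2 k) - bump' q\<^sup>3 / (6 k\<^sup>2)\<close>. The boundary terms vanish because the bump has
  double zeros at 1/2 and 3/4. The gain is the factor \<open>1 / k\<^sup>2\<close>, which is summable over the slopes.
\<close>

lemma ramp_integral_by_parts: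
  assumes "k \<noteq> 0"
  shows "ramp_integral k d
    = integral {1/2..3/4} (\<lambda>x. bump2 x * pos_part (k * x + d) ^ 3) / (6 * k\<^sup>2)"
proof -
  let ?q = "\<lambda>x. pos_part (k * x + d)"
  let ?w1 = "\<lambda>x. 2 * ((x - 1/2) * (3/4 - x)) * ((3/4 - x) - (x - 1/2))"
  let ?F = "\<lambda>x. bump x * (?q x ^ 2 / (2 * k)) - ?w1 x * (?q x ^ 3 / (6 * k\<^sup>2))"
  have p2: "((\<lambda>t. pos_part t ^ 2) has_real_derivative 2 * pos_part t) (at t)" for t
    using has_derivative_pos_part_power[of 0 t] by (simp add: numeral_2_eq_2)
  have p3: "((\<lambda>t. pos_part t ^ 3) has_real_derivative 3 * pos_part t ^ 2) (at t)" for t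
    using has_derivative_pos_part_power[of 1 t] by (simp add: numeral_2_eq_2 numeral_3_eq_3)
  have lin: "((\<lambda>x. k * x + d) has_real_derivative k) (at x)" for x
    by (auto intro!: derivative_eq_intros)
  have d2: "((\<lambda>x. ?q x ^ 2) has_real_derivative (2 * ?q x) * k) (at x)" for x
    by (rule DERIV_chain2[where f = "\<lambda>t. pos_part t ^ 2", OF p2 lin])
  have d3: "((\<lambda>x. ?q x ^ 3) has_real_derivative (3 * ?q x ^ 2) * k) (at x)" for x
    by (rule DERIV_chain2[where f = "\<lambda>t. pos_part t ^ 3", OF p3 lin])
  have w: "(bump has_real_derivative ?w1 x) (at x)" for x
    unfolding bump_def by (auto intro!: derivative_eq_intros simp: field_simps power2_eq_square)
  have w1: "(?w1 has_real_derivative bump2 x) (at x)" for x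
    unfolding bump2_def by (auto intro!: derivative_eq_intros simp: field_simps power2_eq_square)
  have "(?F has_real_derivative bump x * ?q x - bump2 x * ?q x ^ 3 / (6 * k\<^sup>2)) (at x)" for x
    by (rule DERIV_cong[OF DERIV_diff[OF DERIV_mult[OF w DERIV_cdivide[OF d2]]
        DERIV_mult[OF w1 DERIV_cdivide[OF d3]]]])
      (use assms in \<open>simp add: field_simps power2_eq_square\<close>)
  then have "((\<lambda>x. bump x * ?q x - bump2 x * ?q x ^ 3 / (6 * k\<^sup>2)) has_integral ?F (3/4) - ?F (1/2)) {1/2..3/4}"
    by (intro fundamental_theorem_of_calculus)
      (auto simp: has_real_derivative_iff_has_vector_derivative[symmetric] intro: has_field_derivative_at_within)
  then have "integral {1/2..3/4} (\<lambda>x. bump x * ?q x - bump2 x * ?q x ^ 3 / (6 * k\<^sup>2)) = 0"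
    by (simp add: integral_unique bump_def)
  moreover have "integral {1/2..3/4} (\<lambda>x. bump x * ?q x - bump2 x * ?q x ^ 3 / (6 * k\<^sup>2))
    = ramp_integral k d - integral {1/2..3/4} (\<lambda>x. bump2 x * ?q x ^ 3 / (6 * k\<^sup>2))"
    unfolding ramp_integral_def
    by (intro Henstock_Kurzweil_Integration.integral_diff integrable_continuous_real continuous_intros)
      (use assms in auto)
  ultimately show ?thesis by simp
qed

lemma diff4_integral:
  assumes "\<And>d. continuous_on {1/2..3/4} (\<lambda>x. f x * G (k * x + d))"
  shows "diff4 (\<lambda>d. integral {1/2..3/4::real} (\<lambda>x. f x * G (k * x + d))) e
    = integral {1/2..3/4} (\<lambda>x. f x * diff4 G (k * x + e))"
proof -
  have i: "((\<lambda>x. f x * G (k * x + d)) has_integral integral {1/2..3/4} (\<lambda>x. f x * G (k * x + d))) {1/2..3/4}" for d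
    using assms integrable_continuous_real integrable_integral by blast
  have "((\<lambda>x. f x * G (k * x + (e - 2)) - 4 * (f x * G (k * x + (e - 1))) + 6 * (f x * G (k * x + e))
      - 4 * (f x * G (k * x + (e + 1))) + f x * G (k * x + (e + 2)))
    has_integral diff4 (\<lambda>d. integral {1/2..3/4} (\<lambda>x. f x * G (k * x + d))) e) {1/2..3/4}"
    unfolding diff4_def
    by (intro has_integral_add has_integral_diff has_integral_mult_right i)
  then show ?thesis
    unfolding diff4_def by (intro integral_unique[symmetric]) (simp add: algebra_simps)
qed

lemma bump_mass: "integral {1/2..3/4} bump > 0"
proof -
  let ?F = "\<lambda>x::real. (x - 1/2)^3 / 48 - (x - 1/2)^4 / 8 + (x - 1/2)^5 / 5"
  have "(?F has_real_derivative bump x) (at x)" for x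
  proof -
    define y where "y = x - 1/2"
    have "bump x = 3 * y^2 / 48 - 4 * y^3 / 8 + 5 * y^4 / 5"
    proof -
      have "3/4 - x = 1/4 - y" by (simp add: y_def)
      then have "bump x = (y * (1/4 - y))\<^sup>2" by (simp add: bump_def y_def)
      then show ?thesis by (simp add: power2_eq_square power3_eq_cube power4_eq_xxxx field_simps)
    qed
    then show ?thesis
      unfolding y_def by (auto intro!: derivative_eq_intros)
  qed
  then have "(bump has_integral ?F (3/4) - ?F (1/2)) {1/2..3/4}"
    by (intro fundamental_theorem_of_calculus)
      (auto simp: has_real_derivative_iff_has_vector_derivative[symmetric] intro: has_field_derivative_at_within)
  then show ?thesis by (simp add: integral_unique power_numeral_reduce)
qed

lemma ramp_integral_0: "ramp_integral 0 d = integral {1/2..3/4} bump * pos_part d"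
  by (simp add: ramp_integral_def)

lemma diff4_ramp_0: "diff4 (ramp_integral 0) e = integral {1/2..3/4} bump * diff4 (\<lambda>t. pos_part t ^ 1) e"
  by (simp add: diff4_def ramp_integral_0 algebra_simps)

lemma sum_diff4_ramp_parallel_le:
  "(\<Sum>l'<N. \<bar>diff4 (ramp_integral 0) (t - real l')\<bar>) \<le> 2048 * integral {1/2..3/4} bump"
proof -
  have "(\<Sum>l'<N. \<bar>diff4 (ramp_integral 0) (t - real l')\<bar>)
    = integral {1/2..3/4} bump * (\<Sum>l'<N. \<bar>diff4 (\<lambda>t. pos_part t ^ 1) (t - real l')\<bar>)"
    using bump_mass by (simp add: diff4_ramp_0 abs_mult sum_distrib_left)
  also have "\<dots> \<le> integral {1/2..3/4} bump * (4 * 512)"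
    using bump_mass
    by (intro mult_left_mono sum_lattice_translates_le diff4_pos_part_power_eq_0 abs_diff4_pos_part_power_le) auto
  finally show ?thesis by simp
qed

text \<open>
  Lines crossing at a slope difference \<open>k\<close>: after the integration by parts the fourth difference falls on a
  cubic ramp and becomes a compactly supported spline, so for each \<open>x\<close> only a few
  heights contribute.
\<close>

lemma sum_diff4_ramp_transversal_le:
  assumes "k \<noteq> 0"
  shows "(\<Sum>l'<N. \<bar>diff4 (ramp_integral k) (t - real l')\<bar>) \<le> 512 / k\<^sup>2"
proof -
  let ?Q = "\<lambda>t. diff4 (\<lambda>t. pos_part t ^ 3) t"
  have cQ: "continuous_on S (\<lambda>x. ?Q (k * x + c))" for S c
    unfolding diff4_def by (intro continuous_intros)
  have one: "\<bar>diff4 (ramp_integral k) e\<bar> \<le> integral {1/2..3/4} (\<lambda>x. \<bar>?Q (k * x + e)\<bar>) / (6 * k\<^sup>2)" for e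
  proof -
    have "diff4 (ramp_integral k) e
      = diff4 (\<lambda>d. integral {1/2..3/4} (\<lambda>x. bump2 x * pos_part (k * x + d) ^ 3)) e / (6 * k\<^sup>2)"
      unfolding diff4_def ramp_integral_by_parts[OF assms] by (simp add: add_divide_distrib diff_divide_distrib)
    also have "\<dots> = integral {1/2..3/4} (\<lambda>x. bump2 x * ?Q (k * x + e)) / (6 * k\<^sup>2)"
      by (subst diff4_integral) (intro continuous_intros, simp)
    finally have eq: "diff4 (ramp_integral k) e = \<dots>" .
    have "\<bar>integral {1/2..3/4} (\<lambda>x. bump2 x * ?Q (k * x + e))\<bar>
      \<le> integral {1/2..3/4} (\<lambda>x. \<bar>?Q (k * x + e)\<bar>)"
    proof (subst real_norm_def[symmetric], rule integral_norm_bound_integral)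
      fix x :: real assume "x \<in> {1/2..3/4}"
      then show "norm (bump2 x * ?Q (k * x + e)) \<le> \<bar>?Q (k * x + e)\<bar>"
        using mult_right_mono[OF abs_bump2_le, of x "\<bar>?Q (k * x + e)\<bar>"] by (simp add: abs_mult)
    qed (intro integrable_continuous_real continuous_intros cQ)+
    then show ?thesis unfolding eq by (simp add: divide_right_mono)
  qed
  have "(\<Sum>l'<N. \<bar>diff4 (ramp_integral k) (t - real l')\<bar>)
    \<le> (\<Sum>l'<N. integral {1/2..3/4} (\<lambda>x. \<bar>?Q (k * x + (t - real l'))\<bar>) / (6 * k\<^sup>2))"
    by (intro sum_mono one)
  also have "\<dots> = integral {1/2..3/4} (\<lambda>x. \<Sum>l'<N. \<bar>?Q (k * x + (t - real l'))\<bar>) / (6 * k\<^sup>2)"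
    by (subst integral_sum)
      (auto intro!: integrable_continuous_real continuous_intros cQ simp: sum_divide_distrib)
  also have "\<dots> \<le> integral {1/2..3/4::real} (\<lambda>x. 4 * 512) / (6 * k\<^sup>2)"
  proof (intro divide_right_mono integral_le)
    fix x :: real
    have "(\<Sum>l'<N. \<bar>?Q ((k * x + t) - real l')\<bar>) \<le> 4 * 512"
      by (intro sum_lattice_translates_le diff4_pos_part_power_eq_0 abs_diff4_pos_part_power_le) auto
    then show "(\<Sum>l'<N. \<bar>?Q (k * x + (t - real l'))\<bar>) \<le> 4 * 512"
      by (simp add: add_diff_eq)
  qed (intro integrable_continuous_real continuous_intros cQ | simp)+
  also have "\<dots> \<le> 512 / k\<^sup>2" using assms by (simp add: field_simps)
  finally show ?thesis .
qed

lemma sum_inverse_squares_le: "(\<Sum>m=1..n. 1 / (real m)\<^sup>2) \<le> 2"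
proof -
  have "(\<Sum>m=1..Suc n. 1 / (real m)\<^sup>2) \<le> 2 - 1 / real (Suc n)" for n
  proof (induction n)
    case (Suc n)
    have "1 / (real (Suc (Suc n)))\<^sup>2 \<le> 1 / (real (Suc n) * real (Suc (Suc n)))"
      unfolding power2_eq_square by (intro divide_left_mono mult_right_mono) auto
    also have "\<dots> = 1 / real (Suc n) - 1 / real (Suc (Suc n))" by (simp add: field_simps)
    finally show ?case using Suc unfolding sum.atLeast_Suc_atMost_Suc_shift by simp
  qed simp
  note * = this
  show ?thesis
  proof (cases n)
    case (Suc m)
    have "0 \<le> 1 / real n" by simp
    then show ?thesis using *[of m] unfolding Suc by linarith
  qed simp
qed

lemma sum_inverse_square_gaps_le:
  assumes "j < N"
  shows "(\<Sum>j'\<in>{..<N} - {j}. 1 / (real j - real j')\<^sup>2) \<le> 4"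
proof -
  have split: "{..<N} - {j} = {..<j} \<union> {j<..<N}" using assms by auto
  have "(\<Sum>j'\<in>{..<N} - {j}. 1 / (real j - real j')\<^sup>2)
    = (\<Sum>j'<j. 1 / (real j - real j')\<^sup>2) + (\<Sum>j'\<in>{j<..<N}. 1 / (real j - real j')\<^sup>2)"
    unfolding split by (rule sum.union_disjoint) auto
  also have "(\<Sum>j'<j. 1 / (real j - real j')\<^sup>2) = (\<Sum>m=1..j. 1 / (real m)\<^sup>2)"
    by (rule sum.reindex_bij_witness[of _ "\<lambda>m. j - m" "\<lambda>j'. j - j'"]) (auto simp: of_nat_diff)
  also have "(\<Sum>j'\<in>{j<..<N}. 1 / (real j - real j')\<^sup>2) = (\<Sum>m=1..N - j - 1. 1 / (real m)\<^sup>2)"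
    by (rule sum.reindex_bij_witness[of _ "\<lambda>m. j + m" "\<lambda>j'. j' - j"])
      (auto simp: of_nat_diff power2_commute[of "real j"])
  finally show ?thesis
    using sum_inverse_squares_le[of j] sum_inverse_squares_le[of "N - j - 1"] by linarith
qed

text \<open>
  This bounds the row sums of the Gram matrix of the atoms defined below, uniformly in the grid
  size \<open>N\<close>: parallel lines interact only with their nearest neighbours, and the transversal ones contribute
  \<open>\<Sum>k\<noteq>0. 1 / k\<^sup>2\<close>.
\<close>

lemma sum_diff4_ramp_le:
  assumes "j < N"
  shows "(\<Sum>j'<N. \<Sum>l'<N. \<bar>diff4 (ramp_integral (real j - real j')) (t - real l')\<bar>)
    \<le> 2048 * (integral {1/2..3/4} bump + 1)"
proof -
  have "(\<Sum>j'<N. \<Sum>l'<N. \<bar>diff4 (ramp_integral (real j - real j')) (t - real l')\<bar>)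
    = (\<Sum>l'<N. \<bar>diff4 (ramp_integral 0) (t - real l')\<bar>)
      + (\<Sum>j'\<in>{..<N} - {j}. \<Sum>l'<N. \<bar>diff4 (ramp_integral (real j - real j')) (t - real l')\<bar>)"
    using assms by (subst sum.remove[of _ j]) auto
  also have "\<dots> \<le> 2048 * integral {1/2..3/4} bump
      + (\<Sum>j'\<in>{..<N} - {j}. 512 * (1 / (real j - real j')\<^sup>2))"
    using sum_diff4_ramp_transversal_le by (intro add_mono sum_diff4_ramp_parallel_le sum_mono) auto
  also have "\<dots> \<le> 2048 * integral {1/2..3/4} bump + 512 * 4"
    unfolding sum_distrib_left[symmetric]
    by (intro add_left_mono mult_left_mono sum_inverse_square_gaps_le assms) simp
  finally show ?thesis by simp
qed

section \<open>A grid of discs and their second differences\<close>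

text \<open>
  Centre and squared radius are chosen such that the disc is
  \<open>(x - 1/2)\<^sup>2 + (y - 1/2)\<^sup>2 \<le> 1/16 + \<delta> (j x + l)\<close> with \<open>\<delta> = 1 / (64 N)\<close>: in the coordinates
  \<open>(x, Y)\<close>, a half-plane of slope \<open>\<delta> j\<close> and height \<open>1/16 + \<delta> l\<close>. Slopes and heights have the same
  spacing \<open>\<delta>\<close>, and the constant 64 keeps radii and centres in a fixed range for \<open>j < N\<close> and \<open>l < N + 2\<close>.
\<close>

definition scan_disc :: "nat \<Rightarrow> nat \<Rightarrow> nat \<Rightarrow> (real \<times> real) set" where
  "scan_disc N j l = disc (1/2 + real j / (128 * real N), 1/2)
    (1/16 + real l / (64 * real N) + real j / (128 * real N) + (real j / (128 * real N))\<^sup>2)"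

lemma mem_scan_disc:
  assumes "0 < N"
  shows "z \<in> scan_disc N j l \<longleftrightarrow>
    (fst z - 1/2)\<^sup>2 + (snd z - 1/2)\<^sup>2 \<le> 1/16 + (real j * fst z + real l) / (64 * real N)"
proof -
  define a where "a = real j / (128 * real N)"
  have "(real j * fst z + real l) / (64 * real N) = 2 * a * fst z + real l / (64 * real N)"
    using assms by (simp add: a_def field_simps)
  moreover have "(norm (z - (1/2 + a, 1/2)))\<^sup>2
    = (fst z - 1/2)\<^sup>2 + (snd z - 1/2)\<^sup>2 - 2 * a * (fst z - 1/2) + a\<^sup>2"
    unfolding power2_norm_eq_inner by (simp add: inner_prod_def power2_eq_square algebra_simps)
  ultimately show ?thesis
    unfolding scan_disc_def disc_def mem_Collect_eq a_def[symmetric] by (auto simp: algebra_simps)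
qed

lemma holder_domain_scan_disc:
  assumes D: "\<And>\<rho> c. \<rho> \<in> {1/16..1/8} \<Longrightarrow> c \<in> {1/2..17/32} \<times> {1/2} \<Longrightarrow>
      holder_domain s R M (disc c \<rho>)"
    and "j < N" "l < N + 2"
  shows "holder_domain s R M (scan_disc N j l)"
  unfolding scan_disc_def
proof (rule D)
  define a where "a = real j / (128 * real N)"
  define b where "b = real l / (64 * real N)"
  have a: "0 \<le> a" "a \<le> 1/128" using assms(2) by (auto simp: a_def field_simps)
  have b: "0 \<le> b" "b \<le> 1/32" using assms(2,3) by (auto simp: b_def field_simps)
  have "a\<^sup>2 \<le> (1/128)\<^sup>2" using a by (intro power_mono) auto
  then have "a\<^sup>2 \<le> 1/128" by (simp add: power2_eq_square)
  then have "1/16 + b + a + a\<^sup>2 \<in> {1/16..1/8}" using a b by auto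
  then show "1/16 + real l / (64 * real N) + real j / (128 * real N) + (real j / (128 * real N))\<^sup>2 \<in> {1/16..1/8}"
    by (simp only: a_def b_def)
  show "(1/2 + real j / (128 * real N), 1/2) \<in> {1/2..17/32} \<times> {1/2}"
    using a by (simp add: a_def)
qed

definition scan :: "nat \<Rightarrow> nat \<Rightarrow> nat \<Rightarrow> L2_square" where
  "scan N j l = abs_L2_square (indicat_real (scan_disc N j l))"

text \<open>
  The part of the inner product of two discs that depends on one of them only; it is
  annihilated by taking differences in the height of the other.
\<close>

definition scan_mass :: "nat \<Rightarrow> nat \<Rightarrow> nat \<Rightarrow> real" where
  "scan_mass N j l = integral {1/2..3/4}
    (\<lambda>x. bump x * (1/16 + (real j * x + real l) / (64 * real N) - (x - 1/2)\<^sup>2))"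

lemma inner_window_mult_scan:
  assumes sq: "\<And>j l. j < N \<Longrightarrow> l < N + 2 \<Longrightarrow> square_integrable_on_square (indicat_real (scan_disc N j l))"
    and jl: "j < N" "l < N + 2" "j' < N" "l' < N + 2"
  shows "inner (window_mult (scan N j l)) (window_mult (scan N j' l'))
    = scan_mass N j l - ramp_integral (real j - real j') (real l - real l') / (64 * real N)"
proof -
  have N: "0 < N" using jl by simp
  define h where "h x = 1/16 + min (real j * x + real l) (real j' * x + real l') / (64 * real N)" for x
  have "inner (window_mult (scan N j l)) (window_mult (scan N j' l'))
    = integral {1/2..3/4} (\<lambda>x. ((x - 1/2) * (3/4 - x))\<^sup>2 * (h x - (x - 1/2)\<^sup>2))"
    unfolding scan_def
  proof (rule inner_window_mult_indicator)
    show "continuous_on UNIV h" unfolding h_def by (intro continuous_intros) (use N in auto)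
    fix x :: real assume x: "x \<in> {1/2..3/4}"
    have "0 \<le> min (real j * x + real l) (real j' * x + real l') / (64 * real N)"
      using x by simp
    moreover have "(x - 1/2)\<^sup>2 \<le> (1/4)\<^sup>2" using x by (intro power_mono) auto
    ultimately show "(x - 1/2)\<^sup>2 \<le> h x" unfolding h_def power2_eq_square[of "1/4"] by linarith
    have "real j * x \<le> real N * 1" using x jl by (intro mult_mono) auto
    then have "min (real j * x + real l) (real j' * x + real l') \<le> 3 * real N" using jl by auto
    then have "min (real j * x + real l) (real j' * x + real l') / (64 * real N) \<le> 3/64"
      using N by (simp add: divide_le_eq)
    then show "h x \<le> 1/4" unfolding h_def by linarith
  next
    fix z
    have "a \<le> 1/16 + p / (64 * real N) \<and> a \<le> 1/16 + q / (64 * real N)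
      \<longleftrightarrow> a \<le> 1/16 + min p q / (64 * real N)" for a p q
      using N by (cases "p \<le> q") (auto simp: min_def field_simps)
    then show "z \<in> scan_disc N j l \<inter> scan_disc N j' l'
      \<longleftrightarrow> (fst z - 1/2)\<^sup>2 + (snd z - 1/2)\<^sup>2 \<le> h (fst z)"
      by (simp add: mem_scan_disc[OF N] h_def)
  qed (use sq jl in auto)
  also have "\<dots> = integral {1/2..3/4} (\<lambda>x. bump x * (1/16 + (real j * x + real l) / (64 * real N) - (x - 1/2)\<^sup>2)
      - bump x * pos_part ((real j - real j') * x + (real l - real l')) / (64 * real N))"
  proof (rule arg_cong[where f = "integral {1/2..3/4}"], rule ext)
    fix x
    have min: "min (real j * x + real l) (real j' * x + real l')
      = (real j * x + real l) - pos_part ((real j - real j') * x + (real l - real l'))"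
      by (auto simp: min_def max_def algebra_simps)
    have "w * (1/16 + (p - q) / d - e) = w * (1/16 + p / d - e) - w * q / d" for w p q d e :: real
      by (simp add: diff_divide_distrib algebra_simps)
    then show "((x - 1/2) * (3/4 - x))\<^sup>2 * (h x - (x - 1/2)\<^sup>2)
      = bump x * (1/16 + (real j * x + real l) / (64 * real N) - (x - 1/2)\<^sup>2)
        - bump x * pos_part ((real j - real j') * x + (real l - real l')) / (64 * real N)"
      unfolding h_def bump_def[symmetric] min .
  qed
  also have "\<dots> = scan_mass N j l
      - integral {1/2..3/4} (\<lambda>x. bump x * pos_part ((real j - real j') * x + (real l - real l')) / (64 * real N))"
    unfolding scan_mass_def
    by (intro Henstock_Kurzweil_Integration.integral_diff integrable_continuous_real continuous_intros)
      (use N in auto)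
  finally show ?thesis by (simp add: ramp_integral_def)
qed

text \<open>
  In the coordinates \<open>(x, Y)\<close> an atom is a difference of two adjacent strips of width \<open>\<delta>\<close>, a wave packet
  with mean zero across its line. The mean zero makes transversal atoms nearly orthogonal.
\<close>

definition atom :: "nat \<Rightarrow> nat \<times> nat \<Rightarrow> L2_square" where
  "atom N = (\<lambda>(j, l). scan N j l - 2 *\<^sub>R scan N j (l + 1) + scan N j (l + 2))"

lemma inner_window_mult_atom:
  assumes sq: "\<And>j l. j < N \<Longrightarrow> l < N + 2 \<Longrightarrow> square_integrable_on_square (indicat_real (scan_disc N j l))"
    and jl: "j < N" "l < N" "j' < N" "l' < N"
  shows "inner (window_mult (atom N (j, l))) (window_mult (atom N (j', l')))
    = - diff4 (ramp_integral (real j - real j')) (real l - real l') / (64 * real N)"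
proof -
  interpret linear window_mult by (rule linear_window_mult)
  define d where "d = real l - real l'"
  have *: "inner (window_mult (scan N j (l + i))) (window_mult (scan N j' (l' + i')))
    = scan_mass N j (l + i) - ramp_integral (real j - real j') (d + (real i - real i')) / (64 * real N)"
    if "i \<le> 2" "i' \<le> 2" for i i'
  proof -
    have "real (l + i) - real (l' + i') = d + (real i - real i')" by (simp add: d_def)
    moreover have "inner (window_mult (scan N j (l + i))) (window_mult (scan N j' (l' + i')))
      = scan_mass N j (l + i) - ramp_integral (real j - real j') (real (l + i) - real (l' + i')) / (64 * real N)"
      by (rule inner_window_mult_scan[OF sq]) (use jl that in auto)
    ultimately show ?thesis by (simp only:)
  qed
  show ?thesis
    using *[of 0 0] *[of 0 1] *[of 0 2] *[of 1 0] *[of 1 1] *[of 1 2] *[of 2 0] *[of 2 1] *[of 2 2]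
    unfolding atom_def diff4_def d_def[symmetric]
    by (simp add: add diff scale inner_add_left inner_add_right inner_diff_left inner_diff_right
        diff_divide_distrib add_divide_distrib)
qed

text \<open>
  The \<open>N\<^sup>2\<close> atoms have squared norm \<open>2 \<delta> W\<close> and Gram row sums of order \<open>\<delta>\<close>. An \<open>n\<close>-dimensional space
  with \<open>n\<close> at most a small multiple of \<open>N\<^sup>2\<close> captures at most half of their energy \<open>2 N\<^sup>2 \<delta> W\<close>. An error below \<open>r\<close> for the
  discs is an error at most \<open>4 r\<close> for the atoms, so the other half is at most \<open>16 N\<^sup>2 r\<^sup>2\<close>; hence
  \<open>16 r\<^sup>2 \<ge> \<delta> W\<close>, which is of order \<open>1 / N\<close>.
\<close>

lemma no_close_subspace:
  assumes H: "\<And>j l. j < N \<Longrightarrow> l < N + 2 \<Longrightarrow> square_integrable_on_square (indicat_real (scan_disc N j l))"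
    and N: "0 < N"
    and n: "real n * (2048 * (integral {1/2..3/4} bump + 1)) \<le> (real N)\<^sup>2 * integral {1/2..3/4} bump"
    and r: "16 * r\<^sup>2 < integral {1/2..3/4} bump / (64 * real N)"
    and B: "finite B" "card B \<le> n"
    and close: "\<And>j l. j < N \<Longrightarrow> l < N + 2 \<Longrightarrow> \<exists>v\<in>span B. norm (scan N j l - v) < r"
  shows False
proof -
  interpret linear window_mult by (rule linear_window_mult)
  define W where "W = integral {1/2..3/4} bump"
  define \<delta> where "\<delta> = 1 / (64 * real N)"
  have \<delta>: "0 < \<delta>" using N by (simp add: \<delta>_def)
  have W: "0 < W" unfolding W_def by (rule bump_mass)
  have inn: "inner (window_mult (atom N (j, l))) (window_mult (atom N (j', l')))
    = - \<delta> * diff4 (ramp_integral (real j - real j')) (real l - real l')"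
    if "j < N" "l < N" "j' < N" "l' < N" for j l j' l'
    using inner_window_mult_atom[OF H that] by (simp add: \<delta>_def)
  define A where "A = {..<N} \<times> {..<N}"
  have "(\<Sum>\<alpha>\<in>A. (norm (window_mult (atom N \<alpha>)))\<^sup>2)
    \<le> real n * (\<delta> * (2048 * (W + 1))) + real (card A) * (4 * r)\<^sup>2"
  proof -
    obtain v where v: "\<And>j l. j < N \<Longrightarrow> l < N + 2 \<Longrightarrow> v j l \<in> span B"
      "\<And>j l. j < N \<Longrightarrow> l < N + 2 \<Longrightarrow> norm (scan N j l - v j l) < r"
      using close by metis
    let ?e = "\<lambda>(j, l). v j l - 2 *\<^sub>R v j (l + 1) + v j (l + 2)"
    show ?thesis
    proof (rule sum_norm_squares_le_of_approx[where B = "window_mult ` B" and e = "\<lambda>\<alpha>. window_mult (?e \<alpha>)"])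
      show "finite A" by (simp add: A_def)
      show "0 \<le> \<delta> * (2048 * (W + 1))" using \<delta> W by simp
      show "finite (window_mult ` B)" using B by simp
      show "card (window_mult ` B) \<le> n" using card_image_le[OF B(1)] B(2) order_trans by blast
    next
      fix \<alpha> assume "\<alpha> \<in> A"
      then obtain j l where \<alpha>: "\<alpha> = (j, l)" "j < N" "l < N" by (auto simp: A_def)
      have "(\<Sum>\<beta>\<in>A. \<bar>inner (window_mult (atom N \<alpha>)) (window_mult (atom N \<beta>))\<bar>)
        = (\<Sum>j'<N. \<Sum>l'<N. \<delta> * \<bar>diff4 (ramp_integral (real j - real j')) (real l - real l')\<bar>)"
        unfolding A_def \<alpha> sum.cartesian_product
        by (intro sum.cong refl) (use inn \<alpha> \<delta> in \<open>auto simp: abs_mult\<close>)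
      also have "\<dots> \<le> \<delta> * (2048 * (W + 1))"
        unfolding sum_distrib_left[symmetric] W_def
        by (intro mult_left_mono sum_diff4_ramp_le \<alpha>) (use \<delta> in auto)
      finally show "(\<Sum>\<beta>\<in>A. \<bar>inner (window_mult (atom N \<alpha>)) (window_mult (atom N \<beta>))\<bar>)
        \<le> \<delta> * (2048 * (W + 1))" .
      have "v j l - 2 *\<^sub>R v j (l + 1) + v j (l + 2) \<in> span B"
        using \<alpha> by (intro span_add span_diff span_scale v) auto
      then have "?e \<alpha> \<in> span B" by (simp only: \<alpha> case_prod_conv)
      then show "window_mult (?e \<alpha>) \<in> span (window_mult ` B)"
        unfolding linear_span_image[OF linear_window_mult] by (rule imageI)
      have "norm (p - 2 *\<^sub>R q + s) \<le> norm p + 2 * norm q + norm s" for p q s :: L2_square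
        using norm_triangle_ineq[of "p - 2 *\<^sub>R q" s] norm_triangle_ineq4[of p "2 *\<^sub>R q"] by simp
      note triangle = this[of "scan N j l - v j l" "scan N j (l + 1) - v j (l + 1)" "scan N j (l + 2) - v j (l + 2)"]
      have split: "atom N \<alpha> - ?e \<alpha> = (scan N j l - v j l) - 2 *\<^sub>R (scan N j (l + 1) - v j (l + 1))
          + (scan N j (l + 2) - v j (l + 2))"
        unfolding \<alpha> atom_def by (simp only: case_prod_conv scaleR_diff_right) simp
      have "norm (scan N j l - v j l) < r" "norm (scan N j (l + 1) - v j (l + 1)) < r"
        "norm (scan N j (l + 2) - v j (l + 2)) < r"
        using \<alpha> by (intro v; simp)+
      then have "norm (atom N \<alpha> - ?e \<alpha>) \<le> 4 * r"
        using triangle unfolding split by linarith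
      then show "norm (window_mult (atom N \<alpha>) - window_mult (?e \<alpha>)) \<le> 4 * r"
        unfolding diff[symmetric] using norm_window_mult_le order_trans by blast
    qed
  qed
  also have "(\<Sum>\<alpha>\<in>A. (norm (window_mult (atom N \<alpha>)))\<^sup>2) = (\<Sum>\<alpha>\<in>A. 2 * \<delta> * W)"
  proof (intro sum.cong refl)
    fix \<alpha> assume "\<alpha> \<in> A"
    then obtain j l where \<alpha>: "\<alpha> = (j, l)" "j < N" "l < N" by (auto simp: A_def)
    have "diff4 (ramp_integral 0) 0 = - 2 * W"
      by (simp add: diff4_ramp_0 W_def) (simp add: diff4_def)
    then show "(norm (window_mult (atom N \<alpha>)))\<^sup>2 = 2 * \<delta> * W"
      using inn[of j l j l] \<alpha> by (simp add: power2_norm_eq_inner)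
  qed
  finally have "(real N)\<^sup>2 * (2 * \<delta> * W) \<le> real n * (\<delta> * (2048 * (W + 1))) + (real N)\<^sup>2 * (4 * r)\<^sup>2"
    by (simp add: A_def power2_eq_square)
  also have "real n * (\<delta> * (2048 * (W + 1))) \<le> \<delta> * ((real N)\<^sup>2 * W)"
    using mult_left_mono[OF n, of \<delta>] \<delta> by (simp add: W_def mult.left_commute mult.commute)
  finally have "(real N)\<^sup>2 * (\<delta> * W) \<le> (real N)\<^sup>2 * (16 * r\<^sup>2)"
    by (simp add: algebra_simps power_mult_distrib)
  then have "\<delta> * W \<le> 16 * r\<^sup>2" using N by simp
  then show False using r by (simp add: \<delta>_def W_def)
qed

section \<open>The lower bound for the widths\<close>

theorem proposition4p4:
  fixes s :: real
  assumes "s \<ge> 1"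
  shows "\<exists>R0 M0 :: real. 0 < R0 \<and> R0 < 1 / 2 \<and> 0 < M0 \<and>
    (\<forall>R M. 0 < R \<and> R \<le> R0 \<and> M0 \<le> M \<longrightarrow>
      (\<exists>c>0. \<forall>n::nat. 1 \<le> n \<longrightarrow>
        kolmogorov_width n (holder_domain_class s R M) \<ge> ereal (c * real n powr (- (1 / 4)))))"
proof -
  obtain M0 where M0: "0 < M0"
    and disc: "\<And>R M \<rho> c. 0 < R \<Longrightarrow> R \<le> 1/16 \<Longrightarrow> M0 \<le> M \<Longrightarrow> \<rho> \<in> {1/16..1/8} \<Longrightarrow>
      c \<in> {1/2..17/32} \<times> {1/2} \<Longrightarrow> holder_domain s R M (disc c \<rho>)"
    using holder_domain_disc[OF assms] by blast
  define W where "W = integral {1/2..3/4} bump"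
  define L where "L = 2048 * (W + 1)"
  have W: "0 < W" unfolding W_def by (rule bump_mass)
  have L: "0 < L" using W by (simp add: L_def)
  define Q where "Q = sqrt (L / W) + 1"
  have Q: "0 < Q" using W L by (simp add: Q_def add_nonneg_pos)
  \<comment> \<open>The factor 2048 leaves a margin of 2 for the strict inequality \<open>16 r\<^sup>2 < W / (64 N)\<close>.\<close>
  define c where "c = sqrt (W / (2048 * Q))"
  have c: "0 < c" using W Q by (simp add: c_def)
  have c2: "c\<^sup>2 = W / (2048 * Q)" unfolding c_def using W Q by (intro real_sqrt_pow2) simp
  have main: "kolmogorov_width n (holder_domain_class s R M) \<ge> ereal (c * real n powr (- (1 / 4)))"
    if R: "0 < R" "R \<le> 1/16" "M0 \<le> M" and n: "1 \<le> n" for R M n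
  proof (rule kolmogorov_width_ge)
    define x where "x = sqrt (real n * L / W)"
    \<comment> \<open>The smallest grid with \<open>n L \<le> N\<^sup>2 W\<close>; its size is of order \<open>sqrt n\<close>.\<close>
    define N where "N = nat \<lceil>x\<rceil>"
    have nLW: "0 < real n * L / W" using n L W by (intro divide_pos_pos mult_pos_pos) auto
    then have pos: "0 < x" by (simp only: x_def real_sqrt_gt_0_iff)
    have "real N = of_int \<lceil>x\<rceil>" using pos by (simp add: N_def)
    then have N: "x \<le> real N" "real N \<le> x + 1" by linarith+
    have N0: "0 < N" using N(1) pos by (cases N) auto
    have "x\<^sup>2 \<le> (real N)\<^sup>2" using N(1) pos by (intro power_mono) auto
    moreover have "x\<^sup>2 = real n * L / W" unfolding x_def using nLW by (intro real_sqrt_pow2) auto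
    ultimately have nL: "real n * L \<le> (real N)\<^sup>2 * W" using W by (simp add: divide_le_eq)
    have "1 \<le> sqrt (real n)" using n by (simp only: real_sqrt_ge_1_iff)
    moreover have "x = sqrt (real n) * sqrt (L / W)"
      unfolding x_def times_divide_eq_right[symmetric] by (rule real_sqrt_mult)
    ultimately have NQ: "real N \<le> Q * sqrt (real n)"
      using N(2) unfolding Q_def ring_distribs by (simp only: mult.commute mult_1)
    have dom: "holder_domain s R M (scan_disc N j l)" if "j < N" "l < N + 2" for j l
      using disc R that by (intro holder_domain_scan_disc) auto
    fix B assume B: "finite B" "card B \<le> n"
      and close: "\<And>u. u \<in> holder_domain_class s R M \<Longrightarrow>
        \<exists>v\<in>span B. norm (u - v) < c * real n powr (- (1 / 4))"
    show False
    proof (rule no_close_subspace[OF _ N0 _ _ B])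
      show "square_integrable_on_square (indicat_real (scan_disc N j l))" if "j < N" "l < N + 2" for j l
        using square_integrable_holder_domain[OF assms R(1) dom[OF that]] .
      show "real n * (2048 * (integral {1/2..3/4} bump + 1)) \<le> (real N)\<^sup>2 * integral {1/2..3/4} bump"
        using nL by (simp add: L_def W_def)
      show "\<exists>v\<in>span B. norm (scan N j l - v) < c * real n powr (- (1 / 4))" if "j < N" "l < N + 2" for j l
        using dom[OF that] by (intro close) (auto simp: scan_def holder_domain_class_def)
      have "(real n powr (- (1/4)))\<^sup>2 = real n powr (- (1/2))"
        by (simp add: power2_eq_square powr_add[symmetric])
      also have "\<dots> = 1 / sqrt (real n)"
        by (simp only: powr_minus_divide powr_half_sqrt of_nat_0_le_iff)
      finally have "16 * (c * real n powr (- (1 / 4)))\<^sup>2 = 16 * (W / (2048 * Q)) / sqrt (real n)"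
        using c2 by (simp only: power_mult_distrib) simp
      also have "\<dots> = W / (128 * (Q * sqrt (real n)))" by simp
      also have "\<dots> < W / (64 * real N)"
      proof (rule divide_strict_left_mono)
        show "64 * real N < 128 * (Q * sqrt (real n))" using NQ N0 by linarith
      qed (use W Q n N0 in auto)
      finally show "16 * (c * real n powr (- (1 / 4)))\<^sup>2 < integral {1/2..3/4} bump / (64 * real N)"
        by (simp add: W_def)
    qed
  qed
  have "\<forall>R M. 0 < R \<and> R \<le> 1/16 \<and> M0 \<le> M \<longrightarrow>
      (\<exists>c>0. \<forall>n::nat. 1 \<le> n \<longrightarrow>
        kolmogorov_width n (holder_domain_class s R M) \<ge> ereal (c * real n powr (- (1 / 4))))"
    using main c by blast
  moreover have "0 < (1/16 :: real)" "1/16 < (1/2 :: real)" by simp_all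
  ultimately show ?thesis using M0 by blast
qed

end
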